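(* Let $k$ be a positive integer and $n\ge 4k+21$. Every 3-graph $H$ on $n$ vertices with $\delta_1(H)\ge kn+6k^2+7k+6$ contains a linear path of length $2k+2$.
   Context: A 3-graph is a simple 3-uniform hypergraph; $\delta_1(H)$ is the minimum over vertices of the number of edges containing the vertex. A linear path of length $k$ is a collection of $k$ edges $e_1,\dots,e_k$ with $|e_i\cap e_j|=1$ if $|i-j|=1$ and $e_i\cap e_j=\emptyset$ otherwise. *)

theory Defs
  imports Main
begin

definition three_graph :: "'a set \<Rightarrow> 'a set set \<Rightarrow> bool" where
  "three_graph V E \<longleftrightarrow> finite V \<and> (\<forall>e\<in>E. e \<subseteq> V \<and> card e = 3)"

definition vertex_degree :: "'a set set \<Rightarrow> 'a \<Rightarrow> nat" where
  "vertex_degree E v = card {e \<in> E. v \<in> e}"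

(* delta_1; only meaningful for nonempty V, as Min {} is unspecified. *)
definition min_vertex_degree :: "'a set \<Rightarrow> 'a set set \<Rightarrow> nat" where
  "min_vertex_degree V E = Min (vertex_degree E ` V)"

(* The edges e_1, ..., e_k of the path are the list entries es ! 0, ..., es ! (k - 1).
   They are distinct by the intersection conditions when all members of E have three elements. *)
definition linear_path :: "'a set set \<Rightarrow> 'a set list \<Rightarrow> bool" where
  "linear_path E es \<longleftrightarrow> set es \<subseteq> E \<and>
     (\<forall>i<length es. \<forall>j<length es. i \<noteq> j \<longrightarrow>
        (if i = Suc j \<or> j = Suc i then card (es ! i \<inter> es ! j) = 1
         else es ! i \<inter> es ! j = {}))"

end

theory Submission
  imports Defs
begin

text \<open>Take a longest linear path, with \<open>l \<le> 2 k + 1\<close> edges, and let \<open>W\<close> be the set of vertices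
  outside it. Since the path cannot be extended, every edge at an end vertex \<open>a\<close> meets the path
  again, so the degree condition yields at least \<open>k + 1\<close> path vertices that share at least four
  edges with \<open>a\<close> whose third vertex lies in \<open>W\<close>. The same holds for the other end \<open>b\<close>. On the other
  hand, rotations and crossings as in the theorems of Ore and Posa show that the neighbours of \<open>a\<close>
  and \<open>b\<close> obtained in this way can be assigned injectively to the \<open>l\<close> edges of the path, provided
  \<open>a\<close> and \<open>b\<close> are chosen suitably among the two vertices of degree one in the end edges. A crossing
  closes the path to a loose cycle with \<open>l + 1\<close> edges. If there is such a cycle, then no edge meets
  it in exactly one vertex, and the path is taken inside the cycle; a crossing would then give
  a second cycle on almost the same vertices, and a vertex that the second cycle misses would have
  too small a degree.\<close>

section \<open>Linear paths as vertex lists\<close>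

text \<open>A path is listed by its vertices: inner even positions hold the vertices shared by
  consecutive edges, while odd positions and both ends lie in one edge. A single vertex is a path
  without edges, so isolated vertices can be glued in as segments.\<close>

fun chain :: "'a set set \<Rightarrow> 'a list \<Rightarrow> bool" where
  "chain E (x # y # z # r) \<longleftrightarrow> {x, y, z} \<in> E \<and> chain E (z # r)"
| "chain E [x] \<longleftrightarrow> True"
| "chain E [] \<longleftrightarrow> False"
| "chain E [x, y] \<longleftrightarrow> False"

lemma chain_odd: "chain E vs \<Longrightarrow> odd (length vs)"
  by (induction E vs rule: chain.induct) auto

text \<open>After a segment of odd length comes the middle vertex of an edge; cutting there destroys
  only that edge.\<close>

lemma chain_append:
  "odd (length P) \<Longrightarrow>
    chain E (P @ y # Q) \<longleftrightarrow> chain E P \<and> chain E Q \<and> {last P, y, hd Q} \<in> E"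
proof (induction E P rule: chain.induct)
  case (2 E x)
  then show ?case by (cases Q) auto
qed auto

lemma triple_rev: "{a, y, b} = {b, y, a}"
  by auto

lemma chain_revI: "chain E vs \<Longrightarrow> chain E (rev vs)"
proof (induction E vs rule: chain.induct)
  case (1 E x y z r)
  then have "chain E (rev (z # r))" by simp
  moreover have "chain E (rev (z # r) @ y # [x])"
    using 1 chain_odd[OF calculation] triple_rev[of x y z]
    by (subst chain_append) (auto simp: last_rev)
  ultimately show ?case by simp
qed auto

lemma chain_rev [simp]: "chain E (rev vs) = chain E vs"
  using chain_revI[of E vs] chain_revI[of E "rev vs"] by auto

lemma chain_swap: "chain E (x # y # z # r) \<longleftrightarrow> chain E (y # x # z # r)"
  by (simp add: insert_commute)

lemma chain_nth:
  assumes "chain E vs" "2 * i + 2 < length vs"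
  shows "{vs ! (2 * i), vs ! (2 * i + 1), vs ! (2 * i + 2)} \<in> E"
  using assms
proof (induction E vs arbitrary: i rule: chain.induct)
  case (1 E x y z r)
  then show ?case
    using "1.IH"[of "i - 1"] by (cases i) auto
qed auto

lemma chain_join:
  "\<lbrakk>chain E P; chain E Q; {last P, y, hd Q} \<in> E\<rbrakk> \<Longrightarrow> chain E (P @ y # Q)"
  by (simp add: chain_append chain_odd)

lemma chain_split:
  assumes "chain E vs" "odd m" "m < length vs"
  shows "chain E (take m vs)" "chain E (drop (Suc m) vs)"
    "vs = take m vs @ vs ! m # drop (Suc m) vs"
    "last (take m vs) = vs ! (m - 1)" "hd (drop (Suc m) vs) = vs ! Suc m"
proof -
  show eq: "vs = take m vs @ vs ! m # drop (Suc m) vs"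
    using assms(3) by (simp add: id_take_nth_drop)
  have "odd (length (take m vs))" using assms by simp
  then show "chain E (take m vs)" "chain E (drop (Suc m) vs)"
    using assms(1) eq chain_append by metis+
  have "m > 0" using assms(2) by (cases m) auto
  then show "last (take m vs) = vs ! (m - 1)"
    using assms(3) by (subst last_conv_nth) auto
  have "Suc m \<noteq> length vs" using chain_odd[OF assms(1)] assms(2) by (metis even_Suc)
  then show "hd (drop (Suc m) vs) = vs ! Suc m"
    using assms(3) by (simp add: hd_drop_conv_nth)
qed

text \<open>The vertices at positions 0 and 1 both have degree one in the path, and exchanging them
  changes no edge. The offsets \<delta> below refer to this choice.\<close>

lemma head_variant:
  assumes "chain E Z" "distinct Z" "j \<le> 1" "j < length Z"
  obtains Z' where "chain E Z'" "distinct Z'" "set Z' = set Z" "length Z' = length Z"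
    "hd Z' = Z ! j" "last Z' = last Z"
proof (cases "j = 0")
  case True
  then show ?thesis using that[of Z] assms by (auto simp: hd_conv_nth)
next
  case False
  then have j: "j = 1" using assms by simp
  from assms j obtain x y z r where Z: "Z = x # y # z # r"
    by (cases "(E, Z)" rule: chain.cases) auto
  show ?thesis
    using that[of "y # x # z # r"] assms chain_swap[of E x y z r] unfolding Z j by auto
qed

lemma tail_variant:
  assumes "chain E Z" "distinct Z" "j \<le> 1" "j < length Z"
  obtains Z' where "chain E Z'" "distinct Z'" "set Z' = set Z" "length Z' = length Z"
    "last Z' = Z ! (length Z - Suc j)" "hd Z' = hd Z"
proof -
  obtain Z' where "chain E Z'" "distinct Z'" "set Z' = set Z" "length Z' = length Z"
    "hd Z' = rev Z ! j" "last Z' = last (rev Z)"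
    using head_variant[of E "rev Z" j] assms by auto
  then show ?thesis
    using that[of "rev Z'"] assms by (auto simp: last_rev hd_rev rev_nth)
qed

text \<open>Edge \<open>i\<close> occupies positions \<open>2 * i\<close> to
  \<open>2 * i + 2\<close>, so only consecutive edges share a position; distinctness carries this
  over to vertices.\<close>

lemma linear_path_chain:
  assumes "chain E vs" "distinct vs" "length vs = 2 * l + 1"
  shows "\<exists>es. length es = l \<and> linear_path E es"
proof -
  define e where "e i = {vs ! (2 * i), vs ! (2 * i + 1), vs ! (2 * i + 2)}" for i
  define es where "es = map e [0..<l]"
  have len: "length es = l" by (simp add: es_def)
  have nth: "es ! i = e i" if "i < l" for i using that by (simp add: es_def)
  have eq: "vs ! i = vs ! j \<longleftrightarrow> i = j" if "i < 2 * l + 1" "j < 2 * l + 1" for i j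
    using that assms nth_eq_iff_index_eq by metis
  have inE: "set es \<subseteq> E"
    using chain_nth[OF assms(1)] assms(3) by (auto simp: es_def e_def)
  have adj: "card (e i \<inter> e (Suc i)) = 1" if "Suc i < l" for i
  proof -
    have "e i \<inter> e (Suc i) = {vs ! (2 * i + 2)}"
      using that by (auto simp: e_def eq)
    then show ?thesis by simp
  qed
  have dis: "e i \<inter> e j = {}" if "i < l" "j < l" "i \<noteq> j" "i \<noteq> Suc j" "j \<noteq> Suc i" for i j
  proof -
    have False if xi: "x \<in> e i" and xj: "x \<in> e j" for x
    proof -
      from xi obtain p where p: "p \<in> {2 * i, 2 * i + 1, 2 * i + 2}" "x = vs ! p"
        by (auto simp: e_def)
      from xj obtain q where q: "q \<in> {2 * j, 2 * j + 1, 2 * j + 2}" "x = vs ! q"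
        by (auto simp: e_def)
      have pl: "p < 2 * l + 1" using p \<open>i < l\<close> by auto
      have ql: "q < 2 * l + 1" using q \<open>j < l\<close> by auto
      have "p = q" using p q eq[OF pl ql] by simp
      then show False using p(1) q(1) \<open>i \<noteq> j\<close> \<open>i \<noteq> Suc j\<close> \<open>j \<noteq> Suc i\<close> by auto
    qed
    then show ?thesis by blast
  qed
  have "linear_path E es"
    unfolding linear_path_def len
    using inE adj dis by (auto simp: nth Int_commute)
  then show ?thesis using len by blast
qed

text \<open>\<open>X\<close> and \<open>Y\<close> are the positions of the neighbours of the first and of the last vertex.
  The neighbours of the first vertex at \<open>2 s\<close> and \<open>2 s + 1\<close>, and those of the last vertex at
  \<open>2 s - 2\<close> and \<open>2 s - 3\<close>, are assigned to slot \<open>s\<close>; if both positions are occupied, the odd one moves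
  to the next slot towards the other end, which \<open>goodX\<close> and \<open>goodY\<close> keep free.\<close>

lemma card_slots:
  fixes X Y :: "nat set"
  assumes X: "X \<subseteq> {1..2 * l - 2}" and Y: "Y \<subseteq> {2..2 * l - 1}"
    and cross: "\<And>i. 2 * i + 4 \<in> X \<or> 2 * i + 5 \<in> X \<Longrightarrow> 2 * i + 2 \<notin> Y \<and> 2 * i + 1 \<notin> Y"
    and common: "\<And>i. 2 * i + 1 \<in> X \<Longrightarrow> 2 * i + 1 \<notin> Y"
    and free: "\<And>i. 2 * i + 2 \<in> X \<or> 2 * i + 3 \<in> X \<Longrightarrow> 2 * i + 1 \<notin> Y"
      "\<And>i. 2 * i + 1 \<in> Y \<or> 2 * i + 2 \<in> Y \<Longrightarrow> 2 * i + 3 \<notin> X"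
    and goodX: "\<And>i. 2 * i + 2 \<in> X \<Longrightarrow> 2 * i + 3 \<in> X \<Longrightarrow> 2 * i + 4 \<notin> X \<and> 2 * i + 5 \<notin> X"
      "1 \<in> X \<Longrightarrow> 2 \<notin> X \<and> 3 \<notin> X"
    and goodY: "\<And>i. 2 * i + 3 \<in> Y \<Longrightarrow> 2 * i + 4 \<in> Y \<Longrightarrow> 2 * i + 1 \<notin> Y \<and> 2 * i + 2 \<notin> Y"
      "2 * l - 1 \<in> Y \<Longrightarrow> 2 * l - 3 \<notin> Y \<and> 2 * l - 2 \<notin> Y"
  shows "card X + card Y \<le> l"
proof -
  \<comment> \<open>Without the exceptions, position \<open>1\<close> would go to slot 0 and, in
    \<open>g\<close>, position \<open>2 * l - 1\<close> to slot \<open>l + 1\<close>; they are moved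
    to slots 1 and \<open>l\<close>.\<close>
  define f where "f x = (if odd x \<and> (x - 1 \<in> X \<or> x = 1) then x div 2 + 1 else x div 2)" for x
  define g where "g x = (if odd x \<and> (x + 1 \<in> Y \<or> x = 2 * l - 1) then x div 2 + 1
    else (x + 1) div 2 + 1)" for x
  have f: "\<exists>t<l. f x = Suc t \<and>
      (x = 2 * t + 2 \<or> x = 2 * t + 3 \<and> 2 * t + 2 \<notin> X \<or> x = 2 * t + 1 \<and> (2 * t \<in> X \<or> t = 0))"
    if "x \<in> X" for x
  proof -
    have x: "1 \<le> x" "x \<le> 2 * l - 2" using that X by auto
    show ?thesis
    proof (cases "odd x \<and> (x - 1 \<in> X \<or> x = 1)")
      case True
      then obtain t where "x = 2 * t + 1" using oddE by blast
      then show ?thesis using True x by (intro exI[of _ t]) (auto simp: f_def)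
    next
      case False
      show ?thesis
      proof (cases "odd x")
        case True
        then obtain t where t: "x = 2 * t + 1" using oddE by blast
        then have "t \<noteq> 0" using False by auto
        then obtain i where "t = Suc i" using not0_implies_Suc by blast
        then show ?thesis using False x t by (intro exI[of _ i]) (auto simp: f_def)
      next
        case even: False
        then obtain t where t: "x = 2 * t" by blast
        then have "t \<noteq> 0" using x by auto
        then obtain i where "t = Suc i" using not0_implies_Suc by blast
        then show ?thesis using x t by (intro exI[of _ i]) (auto simp: f_def)
      qed
    qed
  qed
  have g: "\<exists>t<l. g x = Suc t \<and>
      (x = 2 * t \<and> 1 \<le> t \<or> x = 2 * t - 1 \<and> 1 \<le> t \<and> 2 * t \<notin> Y \<or>
       x = 2 * t + 1 \<and> (2 * t + 2 \<in> Y \<or> t = l - 1))"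
    if "x \<in> Y" for x
  proof -
    have x: "2 \<le> x" "x \<le> 2 * l - 1" using that Y by auto
    show ?thesis
    proof (cases "odd x \<and> (x + 1 \<in> Y \<or> x = 2 * l - 1)")
      case True
      then obtain t where "x = 2 * t + 1" using oddE by blast
      then show ?thesis using True x by (intro exI[of _ t]) (auto simp: g_def)
    next
      case False
      show ?thesis
      proof (cases "odd x")
        case True
        then obtain t where t: "x = 2 * t + 1" using oddE by blast
        then show ?thesis using False x by (intro exI[of _ "t + 1"]) (auto simp: g_def)
      next
        case even: False
        then obtain t where t: "x = 2 * t" by blast
        then show ?thesis using x by (intro exI[of _ t]) (auto simp: g_def)
      qed
    qed
  qed
  have "inj_on f X"
  proof (rule inj_onI)
    fix x x' assume xx: "x \<in> X" "x' \<in> X" "f x = f x'"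
    obtain t where t: "f x = Suc t"
      "x = 2 * t + 2 \<or> x = 2 * t + 3 \<and> 2 * t + 2 \<notin> X \<or> x = 2 * t + 1 \<and> (2 * t \<in> X \<or> t = 0)"
      "x' = 2 * t + 2 \<or> x' = 2 * t + 3 \<and> 2 * t + 2 \<notin> X \<or> x' = 2 * t + 1 \<and> (2 * t \<in> X \<or> t = 0)"
      using f[OF xx(1)] f[OF xx(2)] xx(3) by auto
    \<comment> \<open>A displaced position \<open>2 * t + 1\<close> enters slot
      \<open>t + 1\<close>, whose regular positions must then be unoccupied; \<open>t = 0\<close> is
      the displacement of position 1.\<close>
    have "2 * t + 2 \<notin> X \<and> 2 * t + 3 \<notin> X" if "2 * t + 1 \<in> X" "2 * t \<in> X \<or> t = 0"
      using that goodX(1)[of "t - 1"] goodX(2) X by (cases t) (auto simp: numeral_eq_Suc)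
    then show "x = x'" using t xx by auto
  qed
  moreover have "inj_on g Y"
  proof (rule inj_onI)
    fix x x' assume xx: "x \<in> Y" "x' \<in> Y" "g x = g x'"
    obtain t where t: "g x = Suc t"
      "x = 2 * t \<and> 1 \<le> t \<or> x = 2 * t - 1 \<and> 1 \<le> t \<and> 2 * t \<notin> Y \<or>
       x = 2 * t + 1 \<and> (2 * t + 2 \<in> Y \<or> t = l - 1)"
      "x' = 2 * t \<and> 1 \<le> t \<or> x' = 2 * t - 1 \<and> 1 \<le> t \<and> 2 * t \<notin> Y \<or>
       x' = 2 * t + 1 \<and> (2 * t + 2 \<in> Y \<or> t = l - 1)" "t < l"
      using g[OF xx(1)] g[OF xx(2)] xx(3) by auto
    have "2 * t \<notin> Y \<and> 2 * t - 1 \<notin> Y" if tY: "2 * t + 1 \<in> Y" "2 * t + 2 \<in> Y \<or> t = l - 1" "1 \<le> t"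
    proof (cases "t = l - 1")
      case True
      then have "2 * t + 1 = 2 * l - 1" "2 * t = 2 * l - 2" "2 * t - 1 = 2 * l - 3"
        using t(4) by auto
      then show ?thesis using goodY(2) tY(1) by simp
    next
      case False
      obtain i where "t = Suc i" using tY(3) by (cases t) auto
      then show ?thesis using tY False goodY(1)[of i] by (auto simp: numeral_eq_Suc)
    qed
    then show "x = x'" using t xx by auto
  qed
  moreover have "f ` X \<inter> g ` Y = {}"
  proof -
    have False if xx: "x \<in> X" "x' \<in> Y" "f x = g x'" for x x'
    proof -
      obtain t where t: "t < l"
        "x = 2 * t + 2 \<or> x = 2 * t + 3 \<or> x = 2 * t + 1"
        "x' = 2 * t \<and> 1 \<le> t \<or> x' = 2 * t - 1 \<and> 1 \<le> t \<or> x' = 2 * t + 1"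
      proof -
        obtain t t' where "t < l" "f x = Suc t" "g x' = Suc t'"
          "x = 2 * t + 2 \<or> x = 2 * t + 3 \<or> x = 2 * t + 1"
          "x' = 2 * t' \<and> 1 \<le> t' \<or> x' = 2 * t' - 1 \<and> 1 \<le> t' \<or> x' = 2 * t' + 1"
          using f[OF xx(1)] g[OF xx(2)] by blast
        moreover from this have "t = t'" using xx(3) by simp
        ultimately show ?thesis using that[of t] by blast
      qed
      \<comment> \<open>In a common slot, \<open>cross\<close> excludes two regular positions,
        \<open>common\<close> two displaced ones, and the two parts of \<open>free\<close> a regular
        one with a displaced one.\<close>
      show False
      proof (cases t)
        case 0
        then show False using t xx Y common[of 0] free(1)[of 0] by auto
      next
        case (Suc i)
        then have "x = 2 * i + 4 \<or> x = 2 * i + 5 \<or> x = 2 * i + 3"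
          "x' = 2 * i + 2 \<or> x' = 2 * i + 1 \<or> x' = 2 * i + 3"
          using t by auto
        then show False
          using xx(1,2) cross[of i] free(1)[of "Suc i"] free(2)[of i] common[of "Suc i"]
          by (auto simp: numeral_eq_Suc)
      qed
    qed
    then show ?thesis by auto
  qed
  moreover have "f ` X \<union> g ` Y \<subseteq> {1..l}"
    using f g by fastforce
  moreover have "finite X" "finite Y" using X Y finite_subset by auto
  ultimately have "card X + card Y = card (f ` X \<union> g ` Y)"
    by (simp add: card_Un_disjoint card_image)
  also have "\<dots> \<le> card {1..l}"
    using \<open>f ` X \<union> g ` Y \<subseteq> {1..l}\<close> by (intro card_mono) auto
  finally show ?thesis by simp
qed

section \<open>Longest paths\<close>

text \<open>\<open>heavy E W a x\<close> makes it possible to prescribe up to four third vertices in \<open>W\<close>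
  one after the other, all different.\<close>

definition heavy :: "'a set set \<Rightarrow> 'a set \<Rightarrow> 'a \<Rightarrow> 'a \<Rightarrow> bool" where
  "heavy E W a x \<longleftrightarrow> 4 \<le> card {y \<in> W. {a, y, x} \<in> E}"

lemma heavy_avoid:
  assumes "heavy E W a x" "length F \<le> 3"
  shows "\<exists>y\<in>W - set F. {a, y, x} \<in> E"
proof (rule ccontr)
  assume "\<not> ?thesis"
  then have "{y \<in> W. {a, y, x} \<in> E} \<subseteq> set F" by auto
  then have "card {y \<in> W. {a, y, x} \<in> E} \<le> card (set F)" by (simp add: card_mono)
  also have "\<dots> \<le> 3" using card_length[of F] assms(2) by linarith
  finally show False using assms(1) by (simp add: heavy_def)
qed

lemma heavy_symD: "heavy E W a x \<Longrightarrow> heavy E W x a"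
  by (simp add: heavy_def triple_rev[of x])

text \<open>No path is fixed, only the bound \<open>l\<close> on the number of edges: the arguments
  pass between many paths with \<open>l\<close> edges.\<close>

locale longest_path =
  fixes E :: "'a set set" and l :: nat
  assumes uniform: "e \<in> E \<Longrightarrow> card e = 3"
    and longest: "chain E vs \<Longrightarrow> distinct vs \<Longrightarrow> length vs \<le> 2 * l + 1"
begin

lemma distinct_triple: "{a, y, x} \<in> E \<Longrightarrow> a \<noteq> y \<and> a \<noteq> x \<and> y \<noteq> x"
  using uniform[of "{a, y, x}"] by (auto simp: card_insert_if split: if_splits)

lemma no_extension:
  assumes "chain E vs" "distinct vs" "length vs = 2 * l + 1"
    and "y \<notin> set vs" "z \<notin> set vs"
  shows "{hd vs, y, z} \<notin> E" and "{last vs, y, z} \<notin> E"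
proof -
  have *: "{hd us, y, z} \<notin> E"
    if "chain E us" "distinct us" "length us = 2 * l + 1" "set us = set vs" for us
  proof
    assume e: "{hd us, y, z} \<in> E"
    have "chain E ([z] @ y # us)"
      using that e triple_rev[of z y "hd us"] by (subst chain_append) auto
    moreover have "distinct ([z] @ y # us)"
      using that assms distinct_triple[OF e] by auto
    ultimately show False using longest[of "[z] @ y # us"] that by simp
  qed
  show "{hd vs, y, z} \<notin> E" using *[of vs] assms by auto
  show "{last vs, y, z} \<notin> E"
    using *[of "rev vs"] assms by (auto simp: hd_rev)
qed


section \<open>Replacements that lengthen a path\<close>

lemma no_common_middle:
  assumes "chain E A" "chain E Z" "distinct (A @ q # Z)" "length A + length Z = 2 * l"
    and "{hd A, y, q} \<in> E" "{last Z, y', q} \<in> E"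
    and "y \<noteq> y'" "{y, y'} \<inter> set (A @ q # Z) = {}"
  shows False
proof -
  have ne: "A \<noteq> []" "Z \<noteq> []" using assms by auto
  \<comment> \<open>\<open>A\<close> and \<open>Z\<close> are the segments left when the edge with
    middle \<open>q\<close> is dropped. Both are hung on \<open>q\<close>, so one edge is traded for
    two.\<close>
  have "chain E (rev A @ y # [q] @ y' # rev Z)"
    using assms ne triple_rev[of q y' "last Z"] by (intro chain_join) (auto simp: last_rev hd_rev)
  then show False
    using longest[of "rev A @ y # [q] @ y' # rev Z"] assms by auto
qed

lemma no_free_middle:
  assumes "chain E A" "chain E Z" "distinct (A @ q # Z)" "length A + length Z = 2 * l"
    and "{hd A, y, hd Z} \<in> E" "{last Z, y', q} \<in> E"
    and "y \<noteq> y'" "{y, y'} \<inter> set (A @ q # Z) = {}"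
  shows False
proof -
  have ne: "A \<noteq> []" "Z \<noteq> []" using assms by auto
  \<comment> \<open>One new edge rejoins the segments without \<open>q\<close>, which is then free
    to extend the path at \<open>last Z\<close>.\<close>
  have "chain E (rev A @ y # Z @ y' # [q])"
    using assms ne by (intro chain_join) (auto simp: last_rev hd_append)
  then show False
    using longest[of "rev A @ y # Z @ y' # [q]"] assms by auto
qed

lemma no_free_end:
  assumes "chain E Z" "distinct (v # w # Z)" "length Z = 2 * l - 1" "1 \<le> l"
    and "{v, y, w} \<in> E" "{v, y', hd Z} \<in> E"
    and "y \<noteq> y'" "{y, y'} \<inter> set (v # w # Z) = {}"
  shows False
proof -
  \<comment> \<open>The end edge containing \<open>v\<close> and \<open>w\<close> is replaced by two
    new edges through \<open>v\<close>.\<close>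
  have "chain E ([w] @ y # [v] @ y' # Z)"
    using assms triple_rev[of v y w] by (intro chain_join) auto
  then show False
    using longest[of "[w] @ y # [v] @ y' # Z"] assms by auto
qed

text \<open>A vertex released from the end of the path that sees both neighbours of a removed inner edge
  bridges the gap by two edges, which costs nothing. Two released vertices doing so at different
  gaps, or both seeing the middle of the same gap, yield a longer path.\<close>

lemma no_two_bad:
  assumes R: "chain E R" "distinct R" "length R = 2 * l - 1"
    and uu: "u \<noteq> u'" "{u, u'} \<inter> (set R \<union> W) = {}" and W: "W \<inter> set R = {}"
    and ij: "i \<le> j" "\<delta> \<le> 1" "\<delta>' \<le> 1" "2 * j + 2 + \<delta>' < length R"
    and u: "heavy E W u (R ! (2 * i))" "heavy E W u (R ! (2 * i + 1))"
      "heavy E W u (R ! (2 * i + 2 + \<delta>))"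
    and u': "heavy E W u' (R ! (2 * j))" "heavy E W u' (R ! (2 * j + 1))"
      "heavy E W u' (R ! (2 * j + 2 + \<delta>'))"
  shows False
proof -
  define T Z q where "T = take (2 * j + 1) R" and "Z = drop (2 * j + 2) R" and "q = R ! (2 * j + 1)"
  have sp: "chain E T" "chain E Z" "R = T @ q # Z" "last T = R ! (2 * j)"
    using chain_split[OF R(1), of "2 * j + 1"] ij by (auto simp: T_def Z_def q_def)
  have lT: "length T = 2 * j + 1" using ij by (simp add: T_def)
  have "Z ! \<delta>' = R ! (2 * j + 2 + \<delta>')" "\<delta>' < length Z" "distinct Z"
    using ij R(2) by (auto simp: Z_def)
  then obtain Z' where Z': "chain E Z'" "distinct Z'" "set Z' = set Z" "length Z' = length Z"
    "hd Z' = R ! (2 * j + 2 + \<delta>')"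
    using head_variant[OF sp(2), of \<delta>'] ij by metis
  have dR: "distinct (T @ q # Z)" using R(2) sp(3) by simp
  have lR: "length T + length Z + 2 = 2 * l" "set R = set T \<union> {q} \<union> set Z"
    using sp(3) R(3) ij(4) arg_cong[OF sp(3), of length] by auto
  \<comment> \<open>If both released vertices see \<open>q\<close>, the path runs through
    \<open>M\<close>, \<open>u\<close>, \<open>q\<close>, \<open>u'\<close>, \<open>Z'\<close> along
    four new edges. \<open>T\<close> and \<open>Z\<close> have \<open>2 * l - 2\<close> vertices and
    seven are added, so \<open>M\<close> may lack two vertices of \<open>T\<close>.\<close>
  have via: False
    if M: "chain E M" "set M \<subseteq> set T" "distinct M" "length M + N \<ge> length T" "N \<le> 2"
      and hM: "heavy E W u (last M)" and uq: "heavy E W u q" and uq': "heavy E W u' q" for M N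
  proof -
    obtain y1 where y1: "y1 \<in> W" "{last M, y1, u} \<in> E"
      using heavy_avoid[OF heavy_symD[OF hM], of "[]"] by auto
    obtain y2 where y2: "y2 \<in> W - {y1}" "{u, y2, q} \<in> E"
      using heavy_avoid[OF uq, of "[y1]"] by auto
    obtain y3 where y3: "y3 \<in> W - {y1, y2}" "{q, y3, u'} \<in> E"
      using heavy_avoid[OF heavy_symD[OF uq'], of "[y1, y2]"] by auto
    obtain y4 where y4: "y4 \<in> W - {y1, y2, y3}" "{u', y4, hd Z'} \<in> E"
      using heavy_avoid[OF u'(3), of "[y1, y2, y3]"] Z'(5) by auto
    let ?p = "M @ y1 # [u] @ y2 # [q] @ y3 # [u'] @ y4 # Z'"
    have "chain E ?p"
      using M(1) Z'(1) y1 y2 y3 y4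
      by (intro chain_join) auto
    moreover have "distinct ?p"
      using M Z' y1(1) y2(1) y3(1) y4(1) uu W dR unfolding lR(2) by auto
    ultimately show False
      using longest[of ?p] M(4,5) lR(1) Z'(4) by auto
  qed
  show False
  proof (cases "i = j")
    case True
    then show False
      using via[of T 0] sp(1,4) dR u(1,2) u'(2) by (auto simp: q_def)
  next
    case False
    then have ij': "i < j" using ij by simp
    define M N p where "M = take (2 * i + 1) T" and "N = drop (2 * i + 2) T" and "p = T ! (2 * i + 1)"
    have sp': "chain E M" "chain E N" "T = M @ p # N" "last M = T ! (2 * i)"
      using chain_split[OF sp(1), of "2 * i + 1"] ij' lT by (auto simp: M_def N_def p_def)
    have lM: "length M = 2 * i + 1" "length N = 2 * j - 2 * i - 1"
      using ij' lT by (auto simp: M_def N_def)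
    have TR: "T ! m = R ! m" if "m < 2 * j + 1" for m using that by (simp add: T_def)
    have lastM: "last M = R ! (2 * i)" using sp'(4) TR ij' by simp
    have lastN: "last N = R ! (2 * j)"
      using sp(4) sp'(3) lM(2) ij' by (cases "N = []") auto
    show False
    \<comment> \<open>The third neighbour of \<open>u\<close> lies beyond \<open>N\<close> only if
      \<open>j = i + 1\<close> and \<open>\<delta> = 1\<close>. Then it is \<open>q\<close> itself,
      and \<open>via\<close> applies at the cost of two vertices of \<open>T\<close>.\<close>
    proof (cases "2 * i + 2 + \<delta> \<le> 2 * j")
      case False
      then have "\<delta> = 1" "j = i + 1" using ij ij' by auto
      then have "heavy E W u q" using u(3) by (simp add: q_def)
      then show False
        using via[of M 2] sp' dR u(1) u'(2) lM lT lastM \<open>j = i + 1\<close> by (auto simp: q_def)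
    next
      case True
      have "N ! \<delta> = T ! (2 * i + 2 + \<delta>)"
        using ij' lT by (simp add: N_def)
      moreover have "\<delta> < length N" using True lM ij' by simp
      moreover have "distinct N" using dR sp'(3) by auto
      moreover have "T ! (2 * i + 2 + \<delta>) = R ! (2 * i + 2 + \<delta>)" using TR True by simp
      ultimately obtain N' where N': "chain E N'" "distinct N'" "set N' = set N" "length N' = length N"
        "hd N' = R ! (2 * i + 2 + \<delta>)" "last N' = R ! (2 * j)"
        using head_variant[OF sp'(2), of \<delta>] ij lastN by metis
      obtain y1 where y1: "y1 \<in> W" "{last M, y1, u} \<in> E"
        using heavy_avoid[OF heavy_symD[OF u(1)], of "[]"] lastM by auto
      obtain y2 where y2: "y2 \<in> W - {y1}" "{u, y2, hd N'} \<in> E"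
        using heavy_avoid[OF u(3), of "[y1]"] N'(5) by auto
      obtain y3 where y3: "y3 \<in> W - {y1, y2}" "{last N', y3, u'} \<in> E"
        using heavy_avoid[OF heavy_symD[OF u'(1)], of "[y1, y2]"] N'(6) by auto
      obtain y4 where y4: "y4 \<in> W - {y1, y2, y3}" "{u', y4, hd Z'} \<in> E"
        using heavy_avoid[OF u'(3), of "[y1, y2, y3]"] Z'(5) by auto
      \<comment> \<open>Each of the two gaps loses one vertex of \<open>R\<close> and gains three,
        which makes \<open>2 * l + 3\<close> vertices.\<close>
      let ?p = "M @ y1 # [u] @ y2 # N' @ y3 # [u'] @ y4 # Z'"
      have ne: "N' \<noteq> []" using N'(1) by auto
      have "chain E ?p"
        using sp'(1) N'(1) ne Z'(1) y1 y2 y3 y4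
        by (intro chain_join) (auto simp: hd_append)
      moreover have "distinct ?p"
        using N' Z' y1(1) y2(1) y3(1) y4(1) uu W dR sp'(3) unfolding lR(2) by auto
      ultimately show False
        using longest[of ?p] lM lT lR(1) Z'(4) N'(4) ij' by auto
    qed
  qed
qed

text \<open>Closing one of the paths \<open>us\<close> gives a loose cycle with \<open>l + 1\<close> edges; only those paths are
  considered that arise from a path on \<open>S\<close> by at most one crossing.\<close>

definition no_closing :: "'a set \<Rightarrow> 'a set \<Rightarrow> bool" where
  "no_closing S W \<longleftrightarrow>
    (\<forall>us w y. chain E us \<and> distinct us \<and> length us = 2 * l + 1 \<and> w \<in> W \<and>
      set us \<subseteq> insert w S \<and> y \<in> W - set us \<longrightarrow> {hd us, y, last us} \<notin> E)"

text \<open>\<open>W\<close> need not be the whole complement of the path: for a path inside a loose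
  cycle it also omits the remaining vertex of the cycle.\<close>

definition longest_in :: "'a set \<Rightarrow> 'a list \<Rightarrow> bool" where
  "longest_in W vs \<longleftrightarrow> chain E vs \<and> distinct vs \<and> length vs = 2 * l + 1 \<and>
    W \<inter> set vs = {} \<and> no_closing (set vs) W"

text \<open>This rules out the configuration of \<open>no_two_bad\<close> for the first vertex and
  the path without its first two vertices; it also yields the first part of \<open>goodX\<close> in
  \<open>card_slots\<close>.\<close>

definition good :: "'a set \<Rightarrow> 'a list \<Rightarrow> bool" where
  "good W vs \<longleftrightarrow>
    (\<forall>i \<delta>. \<delta> \<le> 1 \<longrightarrow> 2 * i + 4 + \<delta> \<le> 2 * l \<longrightarrow>
      heavy E W (vs ! 0) (vs ! (2 * i + 2)) \<longrightarrow> heavy E W (vs ! 0) (vs ! (2 * i + 3)) \<longrightarrow>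
      \<not> heavy E W (vs ! 0) (vs ! (2 * i + 4 + \<delta>)))"

lemma longest_in_rev: "longest_in W vs \<Longrightarrow> longest_in W (rev vs)"
  by (simp add: longest_in_def)

lemma no_crossing:
  assumes "chain E A" "chain E Z" "distinct (A @ q # Z)" "length A + length Z = 2 * l"
    and "W \<inter> set (A @ q # Z) = {}" "no_closing (set (A @ q # Z)) W"
    and "heavy E W (hd A) (hd Z)" "heavy E W (last Z) (last A)"
  shows False
proof -
  obtain y where y: "y \<in> W" "{hd A, y, hd Z} \<in> E"
    using heavy_avoid[OF assms(7), of "[]"] by auto
  obtain y' where y': "y' \<in> W - {y}" "{last A, y', last Z} \<in> E"
    using heavy_avoid[OF heavy_symD[OF assms(8)], of "[y]"] by auto
  have ne: "A \<noteq> []" "Z \<noteq> []" using assms by auto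
  \<comment> \<open>The edge through \<open>y'\<close> turns \<open>Z\<close> around and leaves out
    \<open>q\<close>; the edge through \<open>y\<close> then joins the ends. Since \<open>y'\<close>
    enters the path, \<open>no_closing\<close> has to allow one extra vertex of
    \<open>W\<close>.\<close>
  let ?us = "A @ y' # rev Z"
  have "chain E ?us" using assms(1,2) y' ne by (intro chain_join) (auto simp: hd_rev)
  moreover have "distinct ?us" "length ?us = 2 * l + 1" "set ?us \<subseteq> insert y' (set (A @ q # Z))"
    "y \<in> W - set ?us" "y' \<in> W"
    using assms(3-5) y(1) y'(1) by auto
  ultimately have "{hd ?us, y, last ?us} \<notin> E"
    using assms(6) unfolding no_closing_def by blast
  then show False using y(2) ne by (simp add: last_rev)
qed

section \<open>Positions of the heavy neighbours of both ends\<close>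

lemma heavy_range:
  assumes "longest_in W vs" "2 \<le> l" "j \<le> 2 * l" "heavy E W (vs ! 0) (vs ! j)"
  shows "1 \<le> j \<and> j \<le> 2 * l - 2"
proof (rule ccontr)
  assume no: "\<not> ?thesis"
  obtain y where y: "y \<in> W" "{vs ! 0, y, vs ! j} \<in> E"
    using heavy_avoid[OF assms(4), of "[]"] by auto
  have vs: "chain E vs" "distinct vs" "length vs = 2 * l + 1" "W \<inter> set vs = {}" "no_closing (set vs) W"
    using assms(1) by (auto simp: longest_in_def)
  have "j \<noteq> 0" using distinct_triple[OF y(2)] by (cases j) auto
  \<comment> \<open>Only the two degree-one vertices of the last edge remain, and an edge to either
    closes the path itself to a cycle.\<close>
  then obtain \<delta> where \<delta>: "\<delta> \<le> 1" "j = 2 * l - \<delta>"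
    using no assms(3) that[of "2 * l - j"] by auto
  obtain us where us: "chain E us" "distinct us" "set us = set vs" "length us = length vs"
    "last us = vs ! (length vs - Suc \<delta>)" "hd us = hd vs"
    using tail_variant[of E vs \<delta>] vs \<delta> assms(2) by auto
  have "length vs - Suc \<delta> = j" using \<delta> vs(3) by simp
  moreover have "hd vs = vs ! 0" using vs(3) by (cases vs) auto
  ultimately have "{hd us, y, last us} \<in> E" using us(5,6) y(2) by simp
  then show False
    using vs us(1-4) y(1) unfolding no_closing_def
    by (metis Diff_iff disjoint_iff subset_insertI)
qed

text \<open>The cut gives both segments new end edges, and the offsets choose between the two
  degree-one vertices there. For a segment that is a single vertex the bounds force the offset
  0.\<close>

lemma split_variants:
  assumes "longest_in W vs" "2 * i + 2 + \<delta> \<le> 2 * l" "\<delta> \<le> 1" "\<delta>' \<le> 1" "\<delta>' \<le> 2 * i"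
  obtains A Z where "chain E A" "chain E Z" "distinct (A @ vs ! (2 * i + 1) # Z)"
    "length A + length Z = 2 * l" "set (A @ vs ! (2 * i + 1) # Z) = set vs"
    "hd A = vs ! 0" "last A = vs ! (2 * i - \<delta>')" "hd Z = vs ! (2 * i + 2 + \<delta>)" "last Z = vs ! (2 * l)"
proof -
  let ?m = "2 * i + 1"
  have vs: "chain E vs" "distinct vs" "length vs = 2 * l + 1"
    using assms(1) by (auto simp: longest_in_def)
  have m: "odd ?m" "?m < length vs" using vs(3) assms(2) by auto
  define A Z where "A = take ?m vs" and "Z = drop (Suc ?m) vs"
  have AZ: "chain E A" "chain E Z" "vs = A @ vs ! ?m # Z" "length A = ?m"
    using chain_split[OF vs(1) m] m by (auto simp: A_def Z_def)
  have dist: "distinct (A @ vs ! ?m # Z)" using vs(2) AZ(3) by metis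
  have sets: "set (A @ vs ! ?m # Z) = set vs" using AZ(3) by metis
  have lenZ: "length Z = 2 * l - ?m" using vs(3) by (simp add: Z_def)
  have dl: "\<delta> < length Z" using assms(2) lenZ by simp
  obtain A' where A': "chain E A'" "distinct A'" "set A' = set A" "length A' = length A"
    "last A' = A ! (length A - Suc \<delta>')" "hd A' = hd A"
    using tail_variant[OF AZ(1) _ assms(4)] AZ(4) dist assms(5)
    by (metis distinct_append le_imp_less_Suc Suc_eq_plus1)
  obtain Z' where Z': "chain E Z'" "distinct Z'" "set Z' = set Z" "length Z' = length Z"
    "hd Z' = Z ! \<delta>" "last Z' = last Z"
    using head_variant[OF AZ(2) _ assms(3)] dist lenZ dl by auto
  have "hd A = vs ! 0" using m by (cases vs) (auto simp: A_def)
  moreover have "A ! (length A - Suc \<delta>') = vs ! (2 * i - \<delta>')" using m by (simp add: A_def)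
  moreover have "Z ! \<delta> = vs ! (2 * i + 2 + \<delta>)" using vs(3) assms(2) by (simp add: Z_def)
  moreover have "last Z = vs ! (2 * l)"
  proof -
    have "Z \<noteq> []" using dl by auto
    then have "last Z = last vs" using AZ(3) by (metis last_appendR last_ConsR list.distinct(1))
    moreover have "vs \<noteq> []" using vs(3) by auto
    ultimately show ?thesis using vs(3) by (simp add: last_conv_nth)
  qed
  moreover have "distinct (A' @ vs ! ?m # Z')" using A' Z' dist by simp
  ultimately show ?thesis
    using that[of A' Z'] A' Z' sets lenZ AZ(4) assms(2) by simp
qed

lemma heavy_cross:
  assumes "longest_in W vs" "2 * i + 2 + \<delta> \<le> 2 * l" "\<delta> \<le> 1" "\<delta>' \<le> 1" "\<delta>' \<le> 2 * i"
    and "heavy E W (vs ! 0) (vs ! (2 * i + 2 + \<delta>))"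
  shows "\<not> heavy E W (vs ! (2 * l)) (vs ! (2 * i - \<delta>'))"
proof
  assume h: "heavy E W (vs ! (2 * l)) (vs ! (2 * i - \<delta>'))"
  show False
    using split_variants[OF assms(1-5)] no_crossing assms(1,6) h
    unfolding longest_in_def by metis
qed

lemma two_heavy:
  assumes "heavy E W a x" "heavy E W b z" "W \<inter> S = {}"
  obtains y y' where "{a, y, x} \<in> E" "{b, y', z} \<in> E" "y \<noteq> y'" "{y, y'} \<inter> S = {}"
proof -
  obtain y where y: "y \<in> W" "{a, y, x} \<in> E"
    using heavy_avoid[OF assms(1), of "[]"] by auto
  obtain y' where "y' \<in> W - {y}" "{b, y', z} \<in> E"
    using heavy_avoid[OF assms(2), of "[y]"] by auto
  then show ?thesis using that[of y y'] y assms(3) by auto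
qed

lemma heavy_common:
  assumes "longest_in W vs" "2 * i + 2 \<le> 2 * l" "heavy E W (vs ! 0) (vs ! (2 * i + 1))"
  shows "\<not> heavy E W (vs ! (2 * l)) (vs ! (2 * i + 1))"
proof
  assume h: "heavy E W (vs ! (2 * l)) (vs ! (2 * i + 1))"
  have W: "W \<inter> set vs = {}" using assms(1) by (simp add: longest_in_def)
  obtain A Z where AZ: "chain E A" "chain E Z" "distinct (A @ vs ! (2 * i + 1) # Z)"
    "length A + length Z = 2 * l" "set (A @ vs ! (2 * i + 1) # Z) = set vs"
    "hd A = vs ! 0" "last Z = vs ! (2 * l)"
    by (rule split_variants[OF assms(1), of i 0 0]) (use assms(2) in auto)
  show False
    using two_heavy[OF assms(3) h W] no_common_middle[OF AZ(1-4)] AZ(5-7) by metis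
qed

lemma heavy_free:
  assumes "longest_in W vs" "2 * i + 2 + \<delta> \<le> 2 * l" "\<delta> \<le> 1"
    "heavy E W (vs ! 0) (vs ! (2 * i + 2 + \<delta>))"
  shows "\<not> heavy E W (vs ! (2 * l)) (vs ! (2 * i + 1))"
proof
  assume h: "heavy E W (vs ! (2 * l)) (vs ! (2 * i + 1))"
  have W: "W \<inter> set vs = {}" using assms(1) by (simp add: longest_in_def)
  obtain A Z where AZ: "chain E A" "chain E Z" "distinct (A @ vs ! (2 * i + 1) # Z)"
    "length A + length Z = 2 * l" "set (A @ vs ! (2 * i + 1) # Z) = set vs"
    "hd A = vs ! 0" "hd Z = vs ! (2 * i + 2 + \<delta>)" "last Z = vs ! (2 * l)"
    by (rule split_variants[OF assms(1-3), of 0]) auto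
  show False
    using two_heavy[OF assms(4) h W] no_free_middle[OF AZ(1-4)] AZ(5-8) by metis
qed

lemma heavy_free_end:
  assumes "longest_in W vs" "2 \<le> l" "\<delta> \<le> 1" "heavy E W (vs ! 0) (vs ! 1)"
  shows "\<not> heavy E W (vs ! 0) (vs ! (2 + \<delta>))"
proof
  assume h: "heavy E W (vs ! 0) (vs ! (2 + \<delta>))"
  have vs: "chain E vs" "distinct vs" "length vs = 2 * l + 1" "W \<inter> set vs = {}"
    using assms(1) by (auto simp: longest_in_def)
  then obtain v w Z where vwZ: "vs = v # w # Z" "length Z = 2 * l - 1"
    using assms(2) by (cases vs; cases "tl vs") auto
  have "Z \<noteq> []" using vwZ assms(2) by auto
  then have "chain E Z" using vs(1) vwZ(1) by (cases Z) auto
  moreover have "distinct Z" "\<delta> < length Z" using vs(2) vwZ assms(2,3) by auto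
  ultimately obtain Z' where Z': "chain E Z'" "distinct Z'" "set Z' = set Z" "length Z' = length Z"
    "hd Z' = Z ! \<delta>"
    using head_variant[of E Z \<delta>] assms(3) by metis
  have "{v, w} \<inter> set Z' = {}" "v \<noteq> w" "set (v # w # Z') = set vs"
    using vs(2) vwZ(1) Z'(3) by auto
  then show False
    using two_heavy[OF assms(4) h vs(4)] no_free_end[OF Z'(1), of v w] Z' vwZ assms(2)
    by auto
qed

text \<open>The two degree-one vertices of the first edge are the candidates for the front. If both
  failed, both would be bad for the rest of the path, against \<open>no_two_bad\<close>. Only
  positions 0 and 1 change, so the other end can be treated independently.\<close>

lemma ex_good:
  assumes "longest_in W vs" "2 \<le> l"
  obtains us where "longest_in W us" "good W us" "set us = set vs" "us ! 0 \<in> {vs ! 0, vs ! 1}"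
    "\<forall>j\<ge>2. us ! j = vs ! j"
proof (cases "good W vs")
  case True
  then show ?thesis using that[of vs] assms by auto
next
  case False
  have vs: "chain E vs" "distinct vs" "length vs = 2 * l + 1" "W \<inter> set vs = {}"
    using assms(1) by (auto simp: longest_in_def)
  then obtain v w z r where vwR: "vs = v # w # z # r" "length (z # r) = 2 * l - 1"
    using assms(2) by (cases "(E, vs)" rule: chain.cases) auto
  let ?us = "w # v # z # r"
  have us: "longest_in W ?us"
    using assms(1) vwR chain_swap[of E v w z r] by (auto simp: longest_in_def insert_commute)
  have "good W ?us"
  proof (rule ccontr)
    assume "\<not> good W ?us"
    then obtain j \<delta>' where j: "\<delta>' \<le> 1" "2 * j + 4 + \<delta>' \<le> 2 * l"
      "heavy E W w ((z # r) ! (2 * j))" "heavy E W w ((z # r) ! (2 * j + 1))"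
      "heavy E W w ((z # r) ! (2 * j + 2 + \<delta>'))"
      by (auto simp: good_def numeral_eq_Suc)
    obtain i \<delta> where i: "\<delta> \<le> 1" "2 * i + 4 + \<delta> \<le> 2 * l"
      "heavy E W v ((z # r) ! (2 * i))" "heavy E W v ((z # r) ! (2 * i + 1))"
      "heavy E W v ((z # r) ! (2 * i + 2 + \<delta>))"
      using False unfolding vwR(1) by (auto simp: good_def numeral_eq_Suc)
    have R: "chain E (z # r)" "distinct (z # r)" "length (z # r) = 2 * l - 1" "W \<inter> set (z # r) = {}"
      "v \<noteq> w" "{v, w} \<inter> (set (z # r) \<union> W) = {}"
      using vs vwR by auto
    show False
    proof (cases "i \<le> j")
      case True
      show False
        by (rule no_two_bad[OF R(1-3) R(5,6,4) True i(1) j(1) _ i(3-5) j(3-5)])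
          (use j(2) R(3) in simp)
    next
      case False
      show False
        by (rule no_two_bad[OF R(1-3) _ _ R(4) _ j(1) i(1) _ j(3-5) i(3-5)])
          (use i(2) R False in auto)
    qed
  qed
  moreover have "?us ! j = vs ! j" if "2 \<le> j" for j
    using that vwR(1) by (cases j; cases "j - 1") auto
  ultimately show ?thesis using that[of ?us] us vwR(1) by auto
qed

lemma few_heavy:
  assumes "longest_in W vs" "2 \<le> l"
  shows "\<exists>a\<in>{vs ! 0, vs ! 1}. \<exists>b\<in>{vs ! (2 * l), vs ! (2 * l - 1)}.
    card {x \<in> set vs. heavy E W a x} + card {x \<in> set vs. heavy E W b x} \<le> l"
proof -
  obtain ps where ps: "longest_in W ps" "good W ps" "set ps = set vs" "ps ! 0 \<in> {vs ! 0, vs ! 1}"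
    "\<forall>j\<ge>2. ps ! j = vs ! j"
    using ex_good[OF assms] by blast
  obtain qs where qs: "longest_in W qs" "good W qs" "set qs = set (rev ps)"
    "qs ! 0 \<in> {rev ps ! 0, rev ps ! 1}" "\<forall>j\<ge>2. qs ! j = rev ps ! j"
    using ex_good[OF longest_in_rev[OF ps(1)] assms(2)] by (metis set_rev)
  define rs where "rs = rev qs"
  have rs: "longest_in W rs" using longest_in_rev[OF qs(1)] by (simp add: rs_def)
  have len: "length ps = 2 * l + 1" "length qs = 2 * l + 1" "length rs = 2 * l + 1" "distinct rs"
    using ps(1) qs(1) rs by (auto simp: longest_in_def)
  have rq: "rs ! j = qs ! (2 * l - j)" if "j \<le> 2 * l" for j
    using that len by (simp add: rs_def rev_nth)
  \<comment> \<open>The exchange at the back touches only the last two positions. By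
    \<open>heavy_range\<close> no heavy neighbour of \<open>a\<close> lies there, so the front stays
    good.\<close>
  have rp: "rs ! j = ps ! j" if "j \<le> 2 * l - 2" for j
  proof -
    have "rs ! j = rev ps ! (2 * l - j)" using rq that qs(5) assms(2) by simp
    also have "\<dots> = ps ! j" using that len by (simp add: rev_nth)
    finally show ?thesis .
  qed
  define a b where "a = rs ! 0" and "b = rs ! (2 * l)"
  have a: "a \<in> {vs ! 0, vs ! 1}" using rp[of 0] ps(4) by (simp add: a_def)
  have bq: "b = qs ! 0" using rq[of "2 * l"] by (simp add: b_def)
  have "b \<in> {ps ! (2 * l), ps ! (2 * l - 1)}"
    using qs(4) len assms(2) by (auto simp: bq rev_nth)
  then have b: "b \<in> {vs ! (2 * l), vs ! (2 * l - 1)}"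
    using ps(5) assms(2) by simp
  define X Y where "X = {j. j \<le> 2 * l \<and> heavy E W a (rs ! j)}"
    and "Y = {j. j \<le> 2 * l \<and> heavy E W b (rs ! j)}"
  have card_index: "card {x \<in> set vs. P x} = card {j. j \<le> 2 * l \<and> P (rs ! j)}" for P
  proof -
    have "set vs = set rs" using ps(3) qs(3) by (simp add: rs_def)
    then have "{x \<in> set vs. P x} = (!) rs ` {j. j \<le> 2 * l \<and> P (rs ! j)}"
      using len(3) by (auto simp: in_set_conv_nth less_Suc_eq_le)
    moreover have "inj_on ((!) rs) {j. j \<le> 2 * l \<and> P (rs ! j)}"
      using inj_on_nth[OF len(4)] len(3) by auto
    ultimately show ?thesis by (simp add: card_image)
  qed
  have X: "j \<in> X \<Longrightarrow> 1 \<le> j \<and> j \<le> 2 * l - 2" for j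
    using heavy_range[OF rs assms(2)] by (auto simp: X_def a_def)
  have Yq: "j \<in> Y \<longleftrightarrow> j \<le> 2 * l \<and> heavy E W (qs ! 0) (qs ! (2 * l - j))" for j
    using rq by (auto simp: Y_def bq)
  have Y: "2 \<le> j \<and> j \<le> 2 * l - 1" if "j \<in> Y" for j
    using heavy_range[OF qs(1) assms(2), of "2 * l - j"] that Yq[of j] by auto
  have "card X + card Y \<le> l"
  proof (rule card_slots)
    show "X \<subseteq> {1..2 * l - 2}" "Y \<subseteq> {2..2 * l - 1}" using X Y by auto
    fix i
    \<comment> \<open>The offsets cover the four combinations of regular positions in one
      slot.\<close>
    have cross: False if "2 * i + 4 + \<delta> \<in> X" "2 * i + 2 - \<delta>' \<in> Y" "\<delta> \<le> 1" "\<delta>' \<le> 1" for \<delta> \<delta>'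
    proof -
      have "2 * (i + 1) + 2 + \<delta> = 2 * i + 4 + \<delta>" "2 * (i + 1) - \<delta>' = 2 * i + 2 - \<delta>'" by auto
      then have "2 * (i + 1) + 2 + \<delta> \<in> X" "2 * (i + 1) - \<delta>' \<in> Y" using that(1,2) by metis+
      then show False
        using heavy_cross[OF rs, of "i + 1" \<delta> \<delta>'] that(3,4) unfolding X_def Y_def a_def b_def by auto
    qed
    show "2 * i + 2 \<notin> Y \<and> 2 * i + 1 \<notin> Y" if "2 * i + 4 \<in> X \<or> 2 * i + 5 \<in> X"
      using that cross[of 0 0] cross[of 0 1] cross[of 1 0] cross[of 1 1] by (auto simp: ac_simps)
    show "2 * i + 1 \<notin> Y" if "2 * i + 1 \<in> X"
      using that X[OF that] heavy_common[OF rs, of i] by (auto simp: X_def Y_def a_def b_def)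
    show "2 * i + 1 \<notin> Y" if "2 * i + 2 \<in> X \<or> 2 * i + 3 \<in> X"
      using that heavy_free[OF rs, of i 0] heavy_free[OF rs, of i 1]
      by (auto simp: X_def Y_def a_def b_def numeral_3_eq_3)
    show "2 * i + 3 \<notin> X" if "2 * i + 1 \<in> Y \<or> 2 * i + 2 \<in> Y"
    proof
      assume x: "2 * i + 3 \<in> X"
      have qrs: "qs ! (2 * l) = rs ! 0" using rq[of 0] by simp
      have le: "2 * i + 5 \<le> 2 * l" using X[OF x] by auto
      \<comment> \<open>Reversal sends position \<open>j\<close> to \<open>2 * l - j\<close>; the
        claim is \<open>heavy_free\<close> for the reversed path at the reflected index.\<close>
      define i' where "i' = l - i - 2"
      have i': "2 * l - (2 * i + 2) = 2 * i' + 2 + 0" "2 * l - (2 * i + 1) = 2 * i' + 2 + 1"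
        "2 * l - (2 * i + 3) = 2 * i' + 1" "2 * i' + 3 \<le> 2 * l"
        using le by (auto simp: i'_def)
      have "\<exists>\<delta>\<le>1. heavy E W (qs ! 0) (qs ! (2 * i' + 2 + \<delta>))"
        using that Yq i'(1,2) by (metis zero_le order_refl)
      then have "\<not> heavy E W (qs ! (2 * l)) (qs ! (2 * i' + 1))"
        using heavy_free[OF qs(1), of i'] i'(4) by fastforce
      moreover have "qs ! (2 * i' + 1) = rs ! (2 * i + 3)"
        using rq[of "2 * i + 3"] le i'(3) by simp
      ultimately show False using x qrs by (simp add: X_def a_def)
    qed
    show "2 * i + 4 \<notin> X \<and> 2 * i + 5 \<notin> X" if "2 * i + 2 \<in> X" "2 * i + 3 \<in> X"
    proof -
      have False if x: "2 * i + 4 + \<delta> \<in> X" "2 * i + 2 \<in> X" "2 * i + 3 \<in> X" "\<delta> \<le> 1" for \<delta>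
      proof -
        have le: "2 * i + 4 + \<delta> \<le> 2 * l - 2" using X[OF x(1)] by simp
        have "heavy E W (ps ! 0) (ps ! j)" if "j \<in> X" for j
          using that X[OF that] rp[of 0] rp[of j] by (simp add: X_def a_def)
        then show False using ps(2) x le unfolding good_def by (meson diff_le_self le_trans)
      qed
      from this[of 0] this[of 1] show ?thesis using that by (auto simp: ac_simps)
    qed
    show "2 * i + 1 \<notin> Y \<and> 2 * i + 2 \<notin> Y" if "2 * i + 3 \<in> Y" "2 * i + 4 \<in> Y"
    proof -
      have le: "2 * i + 6 \<le> 2 * l" using Y[OF that(2)] by presburger
      define i' where "i' = l - i - 3"
      have i': "2 * l - (2 * i + 4) = 2 * i' + 2" "2 * l - (2 * i + 3) = 2 * i' + 3"
        "2 * l - (2 * i + 2) = 2 * i' + 4 + 0" "2 * l - (2 * i + 1) = 2 * i' + 4 + 1"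
        "2 * i' + 5 \<le> 2 * l"
        using le by (auto simp: i'_def)
      have "\<not> heavy E W (qs ! 0) (qs ! (2 * i' + 4 + \<delta>))" if "\<delta> \<le> 1" for \<delta>
        using qs(2) that \<open>2 * i + 3 \<in> Y\<close> \<open>2 * i + 4 \<in> Y\<close> i' unfolding good_def Yq by auto
      from this[of 0] this[of 1] show ?thesis unfolding Yq using i' by (metis order_refl zero_le)
    qed
  next
    show "2 \<notin> X \<and> 3 \<notin> X" if "1 \<in> X"
      using that heavy_free_end[OF rs assms(2), of 0] heavy_free_end[OF rs assms(2), of 1]
      by (auto simp: X_def a_def)
    show "2 * l - 3 \<notin> Y \<and> 2 * l - 2 \<notin> Y" if "2 * l - 1 \<in> Y"
    proof -
      have "2 * l - (2 * l - 1) = 1" "2 * l - (2 * l - 2) = 2 + 0" "2 * l - (2 * l - 3) = 2 + 1"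
        using assms(2) by auto
      then show ?thesis
        using that heavy_free_end[OF qs(1) assms(2), of 0] heavy_free_end[OF qs(1) assms(2), of 1]
        unfolding Yq by simp
    qed
  qed
  then show ?thesis using a b card_index by (auto simp: X_def Y_def)
qed

end

section \<open>Degrees\<close>

text \<open>By \<open>single\<close>, an edge at \<open>a\<close> has a further vertex in
  \<open>S\<close>. Its other two vertices are either a pair inside \<open>S\<close> or one vertex
  \<open>x\<close> of \<open>S\<close> and one outside.\<close>

lemma degree_le:
  fixes E :: "'a set set"
  assumes "finite V" and E: "\<And>e. e \<in> E \<Longrightarrow> e \<subseteq> V \<and> card e = 3"
    and S: "S \<subseteq> V" "a \<in> S" and single: "\<And>e. e \<in> E \<Longrightarrow> e \<inter> S \<noteq> {a}"
  shows "card {e \<in> E. a \<in> e} \<le>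
    (card S - 1 choose 2) + (\<Sum>x\<in>S - {a}. card {y \<in> V - S. {a, y, x} \<in> E})"
proof -
  define T where "T = S - {a}"
  define D where "D x = {y \<in> V - S. {a, y, x} \<in> E}" for x
  have fin: "finite T" "finite S" "\<And>x. finite (D x)"
    using assms(1) S finite_subset by (auto simp: T_def D_def)
  have cardT: "card T = card S - 1" using S(2) fin by (simp add: T_def)
  have "{e \<in> E. a \<in> e} \<subseteq> insert a ` {p. p \<subseteq> T \<and> card p = 2} \<union> (\<lambda>(x, y). {a, y, x}) ` Sigma T D"
    (is "_ \<subseteq> ?A \<union> ?B")
  proof
    fix e assume "e \<in> {e \<in> E. a \<in> e}"
    then have e: "e \<in> E" "a \<in> e" "card e = 3" "e \<subseteq> V" using E by auto
    then have "card (e - {a}) = 2" by simp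
    then obtain x y where xy: "e - {a} = {x, y}" "x \<noteq> y" by (auto simp: card_2_iff)
    then have exy: "e = {a, x, y}" using e(2) by auto
    have ne: "x \<noteq> a" "y \<noteq> a" using xy by auto
    have "x \<in> S \<or> y \<in> S" using single[OF e(1)] exy S(2) by auto
    moreover have "e \<in> ?A" if "x \<in> S" "y \<in> S"
      using that exy ne xy(2) by (intro image_eqI[of _ _ "{x, y}"]) (auto simp: T_def)
    moreover have "e \<in> ?B" if "x \<in> S" "y \<notin> S"
      using that e exy ne by (intro image_eqI[of _ _ "(x, y)"]) (auto simp: T_def D_def insert_commute)
    moreover have "e \<in> ?B" if "x \<notin> S" "y \<in> S"
      using that e exy ne by (intro image_eqI[of _ _ "(y, x)"]) (auto simp: T_def D_def insert_commute)
    ultimately show "e \<in> ?A \<union> ?B" by blast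
  qed
  then have "card {e \<in> E. a \<in> e} \<le> card (?A \<union> ?B)"
    using fin by (intro card_mono) (auto intro!: finite_imageI)
  also have "\<dots> \<le> card ?A + card ?B" by (rule card_Un_le)
  also have "card ?A \<le> card T choose 2"
    using card_image_le[of "{p. p \<subseteq> T \<and> card p = 2}" "insert a"] fin n_subsets[of T 2] by simp
  also have "card ?B \<le> card (Sigma T D)" using fin by (intro card_image_le) auto
  also have "\<dots> = (\<Sum>x\<in>T. card (D x))" using fin by simp
  finally show ?thesis using cardT by (simp add: T_def D_def)
qed

text \<open>A vertex that is not heavy contributes at most 3 third vertices, a heavy one at most
  \<open>card (V - S)\<close>, which is 3 plus the stated factor.\<close>

lemma degree_le_heavy:
  fixes E :: "'a set set"
  assumes "finite V" and E: "\<And>e. e \<in> E \<Longrightarrow> e \<subseteq> V \<and> card e = 3"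
    and S: "S \<subseteq> V" "a \<in> S" and single: "\<And>e. e \<in> E \<Longrightarrow> e \<inter> S \<noteq> {a}"
    and Y: "Y \<subseteq> S - {a}" "\<And>x y. x \<in> S - {a} - Y \<Longrightarrow> y \<in> V - S \<Longrightarrow> {a, y, x} \<notin> E"
    and W: "3 \<le> card (V - S)"
  shows "card {e \<in> E. a \<in> e} \<le>
    (card S - 1 choose 2) + 3 * card Y + (card (V - S) - 3) * card {x \<in> Y. heavy E (V - S) a x}"
proof -
  define D where "D x = {y \<in> V - S. {a, y, x} \<in> E}" for x
  let ?h = "heavy E (V - S) a"
  have fin: "finite S" "finite Y" using assms(1) S Y finite_subset[of Y S] finite_subset[of S V] by auto
  have "(\<Sum>x\<in>S - {a}. card (D x)) = (\<Sum>x\<in>Y. card (D x))"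
  proof (rule sum.mono_neutral_right)
    show "\<forall>x\<in>S - {a} - Y. card (D x) = 0"
      using Y(2) by (auto simp: D_def card_eq_0_iff)
  qed (use fin Y in auto)
  also have "\<dots> \<le> (\<Sum>x\<in>Y. 3 + (if ?h x then card (V - S) - 3 else 0))"
  proof (rule sum_mono)
    fix x
    have "card (D x) \<le> card (V - S)" using assms(1) by (intro card_mono) (auto simp: D_def)
    then show "card (D x) \<le> 3 + (if ?h x then card (V - S) - 3 else 0)"
      using W by (auto simp: heavy_def D_def)
  qed
  also have "\<dots> = 3 * card Y + (\<Sum>x\<in>Y. if ?h x then card (V - S) - 3 else 0)"
    by (simp add: sum.distrib)
  also have "(\<Sum>x\<in>Y. if ?h x then card (V - S) - 3 else 0) = (card (V - S) - 3) * card {x \<in> Y. ?h x}"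
    using fin by (simp add: sum.If_cases Int_def)
  finally have "(\<Sum>x\<in>S - {a}. card (D x)) \<le>
    3 * card Y + (card (V - S) - 3) * card {x \<in> Y. ?h x}" .
  moreover have "card {e \<in> E. a \<in> e} \<le> (card S - 1 choose 2) + (\<Sum>x\<in>S - {a}. card (D x))"
    unfolding D_def by (rule degree_le[OF assms(1)]) (use E S single in auto)
  ultimately show ?thesis by simp
qed

section \<open>Numerical estimates\<close>

lemma second_cycle_degree_bound:
  fixes k l n :: nat
  assumes "0 < k" "2 \<le> l" "l \<le> 2 * k + 1" "4 * k + 21 \<le> n"
  shows "l * (2 * l + 1) + (n - 2 * l - 2) + (2 * l - 4) * 2 < k * n + 6 * k ^ 2 + 7 * k + 6"
proof -
  obtain i where k: "k = i + 1" using assms(1) by (metis Suc_eq_plus1 gr0_implies_Suc)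
  obtain m where n: "n = 4 * k + 21 + m" using assms(4) le_Suc_ex by blast
  \<comment> \<open>The left side, which bounds the degree of \<open>u\<close> in
    \<open>cycle_no_closing\<close>, grows with \<open>l\<close>, so \<open>l = 2 * k + 1\<close> is
    the critical value.\<close>
  have "l * (2 * l + 1) \<le> (2 * k + 1) * (2 * (2 * k + 1) + 1)"
    using assms(3) by (intro mult_mono) auto
  then have "l * (2 * l + 1) + 2 * l \<le> (2 * k + 1) * (2 * (2 * k + 1) + 1) + 2 * (2 * k + 1)"
    using assms(3) by (intro add_mono) auto
  moreover have "(n - 2 * l - 2) + (2 * l - 4) * 2 + 10 = n + 2 * l"
    using assms by simp
  moreover have "(2 * k + 1) * (2 * (2 * k + 1) + 1) + 2 * (2 * k + 1) + n < k * n + 6 * k ^ 2 + 7 * k + 16"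
    unfolding n k by (simp add: algebra_simps power2_eq_square)
  ultimately show ?thesis by linarith
qed

text \<open>The right side of the last assumption is the bound of \<open>degree_le_heavy\<close>
  when \<open>S\<close> is a path with \<open>2 * l + 1\<close> vertices and \<open>Y\<close> has at
  most \<open>2 * l - 2\<close>.\<close>

lemma heavy_bound_path:
  fixes k l n h :: nat
  assumes "0 < k" "2 \<le> l" "l \<le> 2 * k + 1" "4 * k + 21 \<le> n"
    and "k * n + 6 * k ^ 2 + 7 * k + 6 \<le> l * (2 * l - 1) + 3 * (2 * l - 2) + (n - 2 * l - 4) * h"
  shows "k < h"
proof (rule ccontr)
  assume "\<not> k < h"
  then have "(n - 2 * l - 4) * h \<le> (n - 2 * l - 4) * k" by simp
  then have le: "k * n + 6 * k ^ 2 + 7 * k + 6 \<le> l * (2 * l - 1) + 3 * (2 * l - 2) + (n - 2 * l - 4) * k"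
    using assms(5) by linarith
  \<comment> \<open>\<open>d\<close> is the shortfall of \<open>l\<close> from its largest value.
    The products with \<open>n\<close> cancel and leave a quadratic in \<open>K\<close> without real
    roots plus a nonnegative multiple of \<open>d\<close>.\<close>
  define K N L d :: int where "K = int k" and "N = int n" and "L = int l" and "d = 2 * K + 1 - L"
  have "int (k * n + 6 * k ^ 2 + 7 * k + 6) \<le> int (l * (2 * l - 1) + 3 * (2 * l - 2) + (n - 2 * l - 4) * k)"
    using le by (simp only: of_nat_le_iff)
  moreover have "int (2 * l - 1) = 2 * L - 1" "int (2 * l - 2) = 2 * L - 2" "int (n - 2 * l - 4) = N - 2 * L - 4"
    using assms by (auto simp: L_def N_def)
  ultimately have ineq: "K * N + 6 * K\<^sup>2 + 7 * K + 6 \<le> L * (2 * L - 1) + 3 * (2 * L - 2) + (N - 2 * L - 4) * K"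
    by (simp add: K_def N_def L_def)
  have d: "0 \<le> d" "d \<le> 2 * K" "1 \<le> K" and L: "L = 2 * K + 1 - d"
    using assms by (auto simp: d_def K_def L_def)
  have "2 * K\<^sup>2 - 5 * K + 5 + d * (6 * K + 9 - 2 * d) \<le> 0"
    using ineq unfolding L by (simp add: algebra_simps power2_eq_square)
  moreover have "0 \<le> d * (6 * K + 9 - 2 * d)" using d by simp
  moreover have "0 < 2 * K\<^sup>2 - 5 * K + 5"
  proof -
    have "8 * (2 * K\<^sup>2 - 5 * K + 5) = (4 * K - 5)\<^sup>2 + 15" by (simp add: power2_eq_square algebra_simps)
    also have "0 < \<dots>" by (rule add_nonneg_pos) auto
    finally show ?thesis by simp
  qed
  ultimately show False by linarith
qed

text \<open>Here \<open>S\<close> is a cycle with \<open>2 * l + 2\<close> vertices and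
  \<open>Y\<close> has at most \<open>2 * l - 4\<close>. For \<open>K = 2\<close> and
  \<open>d = 0\<close> the remaining quadratic is 1, so the constant 6 of the degree condition is
  just large enough for this estimate.\<close>

lemma heavy_bound_cycle:
  fixes k l n h :: nat
  assumes "0 < k" "2 \<le> l" "l \<le> 2 * k + 1" "4 * k + 21 \<le> n"
    and "k * n + 6 * k ^ 2 + 7 * k + 6 \<le> l * (2 * l + 1) + 3 * (2 * l - 4) + (n - 2 * l - 5) * h"
  shows "k < h"
proof (rule ccontr)
  assume "\<not> k < h"
  then have "(n - 2 * l - 5) * h \<le> (n - 2 * l - 5) * k" by simp
  then have le: "k * n + 6 * k ^ 2 + 7 * k + 6 \<le> l * (2 * l + 1) + 3 * (2 * l - 4) + (n - 2 * l - 5) * k"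
    using assms(5) by linarith
  define K N L d :: int where "K = int k" and "N = int n" and "L = int l" and "d = 2 * K + 1 - L"
  have "int (k * n + 6 * k ^ 2 + 7 * k + 6) \<le> int (l * (2 * l + 1) + 3 * (2 * l - 4) + (n - 2 * l - 5) * k)"
    using le by (simp only: of_nat_le_iff)
  moreover have "int (2 * l - 4) = 2 * L - 4" "int (n - 2 * l - 5) = N - 2 * L - 5"
    using assms by (auto simp: L_def N_def)
  ultimately have ineq: "K * N + 6 * K\<^sup>2 + 7 * K + 6 \<le> L * (2 * L + 1) + 3 * (2 * L - 4) + (N - 2 * L - 5) * K"
    by (simp only: of_nat_add of_nat_mult of_nat_power of_nat_numeral of_nat_1 K_def N_def L_def)
  have d: "0 \<le> d" "d \<le> 2 * K" "1 \<le> K" and L: "L = 2 * K + 1 - d"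
    using assms by (auto simp: d_def K_def L_def)
  have "2 * K\<^sup>2 - 8 * K + 9 + d * (6 * K + 11 - 2 * d) \<le> 0"
    using ineq unfolding L by (simp add: algebra_simps power2_eq_square)
  moreover have "0 \<le> d * (6 * K + 11 - 2 * d)" using d by simp
  moreover have "0 < 2 * K\<^sup>2 - 8 * K + 9"
  proof -
    have "2 * K\<^sup>2 - 8 * K + 9 = 2 * (K - 2)\<^sup>2 + 1" by (simp add: power2_eq_square algebra_simps)
    also have "0 < \<dots>" by (rule add_nonneg_pos) auto
    finally show ?thesis .
  qed
  ultimately show False by linarith
qed

section \<open>Loose cycles\<close>

locale dense = longest_path E l for E :: "'a set set" and l +
  fixes V :: "'a set" and k :: nat
  assumes finite_V: "finite V" and E_V: "e \<in> E \<Longrightarrow> e \<subseteq> V"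
    and degree: "v \<in> V \<Longrightarrow> k * card V + 6 * k ^ 2 + 7 * k + 6 \<le> card {e \<in> E. v \<in> e}"
    and k_pos: "0 < k" and l_ge: "2 \<le> l" and l_le: "l \<le> 2 * k + 1" and card_V: "4 * k + 21 \<le> card V"
begin

text \<open>A loose cycle with \<open>l + 1\<close> edges, given by the path left after deleting one
  edge; \<open>u\<close> is the middle vertex of the deleted edge.\<close>

definition cycle :: "'a list \<Rightarrow> 'a \<Rightarrow> bool" where
  "cycle vs u \<longleftrightarrow> chain E vs \<and> distinct vs \<and> length vs = 2 * l + 1 \<and> u \<notin> set vs \<and>
    {hd vs, u, last vs} \<in> E"

lemma chain_V: "chain E vs \<Longrightarrow> 2 \<le> length vs \<Longrightarrow> set vs \<subseteq> V"
proof (induction vs rule: induct_list012)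
  case (3 x y r)
  then obtain z r' where r: "r = z # r'" by (cases r) auto
  have "{x, y, z} \<subseteq> V" using 3(3) E_V[of "{x, y, z}"] by (simp add: r)
  moreover have "set r' \<subseteq> V" if "r' \<noteq> []"
    using 3 that by (cases r') (auto simp: r)
  ultimately show ?case by (cases "r' = []") (auto simp: r)
qed auto

lemma cycle_rev: "cycle vs u \<Longrightarrow> cycle (rev vs) u"
  using triple_rev[of "hd vs" u "last vs"] by (auto simp: cycle_def hd_rev last_rev)

text \<open>Deleting the first edge of the path instead lets its middle \<open>y\<close> take over
  the role of \<open>u\<close>.\<close>

lemma cycle_rotate:
  assumes "cycle (x # y # z # r) u"
  shows "cycle (z # r @ [u, x]) y"
proof -
  have c: "chain E (z # r)" "{x, y, z} \<in> E" "{x, u, last (z # r)} \<in> E"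
    "distinct (x # y # z # r)" "u \<notin> set (x # y # z # r)" "length (x # y # z # r) = 2 * l + 1"
    using assms by (auto simp: cycle_def)
  have "chain E ((z # r) @ u # [x])"
    using c triple_rev[of x u "last (z # r)"] by (intro chain_join) auto
  then show ?thesis
    using c triple_rev[of x y z] by (auto simp: cycle_def)
qed

text \<open>Each rotation lowers the position of a vertex by two until \<open>head_variant\<close>
  can bring it to the front. The vertex \<open>u\<close> needs one rotation to get onto the
  path.\<close>

lemma cycle_start:
  assumes "cycle vs u" "x \<in> insert u (set vs)"
  obtains us where "chain E us" "distinct us" "length us = 2 * l + 1" "hd us = x"
    "set us \<subseteq> insert u (set vs)"
proof -
  have ex: "\<exists>us. chain E us \<and> distinct us \<and> length us = 2 * l + 1 \<and> hd us = vs ! j \<and>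
    set us \<subseteq> insert u (set vs)" if "cycle vs u" "j \<le> 2 * l" for vs u j
    using that
  proof (induction j arbitrary: vs u rule: less_induct)
    case (less j)
    have c: "chain E vs" "distinct vs" "length vs = 2 * l + 1"
      using less.prems by (auto simp: cycle_def)
    show ?case
    proof (cases "j \<le> 1")
      case True
      then show ?thesis
        using head_variant[OF c(1,2) True] c(3) l_ge by (metis Suc_1 add.commute le_imp_less_Suc
          less.prems(2) plus_1_eq_Suc subset_insertI)
    next
      case False
      obtain x y z r where vs: "vs = x # y # z # r"
        using c l_ge by (cases "(E, vs)" rule: chain.cases) auto
      have "\<exists>us. chain E us \<and> distinct us \<and> length us = 2 * l + 1 \<and> hd us = (z # r @ [u, x]) ! (j - 2) \<and>
        set us \<subseteq> insert y (set (z # r @ [u, x]))"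
        using less.IH[OF _ cycle_rotate] less.prems False by (simp add: vs)
      moreover have "(z # r @ [u, x]) ! (j - 2) = vs ! j"
        using False less.prems(2) c(3) by (cases j; cases "j - 1") (auto simp: vs nth_append nth_Cons')
      moreover have "insert y (set (z # r @ [u, x])) = insert u (set vs)" by (auto simp: vs)
      ultimately show ?thesis by simp
    qed
  qed
  have c: "chain E vs" "length vs = 2 * l + 1"
    using assms(1) by (auto simp: cycle_def)
  show ?thesis
  proof (cases "x = u")
    case False
    then obtain j where "j \<le> 2 * l" "vs ! j = x"
      using assms(2) c(2) by (auto simp: in_set_conv_nth less_Suc_eq_le)
    then show ?thesis using ex[OF assms(1)] that by blast
  next
    case True
    obtain v w z r where vs: "vs = v # w # z # r"
      using c l_ge by (cases "(E, vs)" rule: chain.cases) auto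
    have "(z # r @ [u, v]) ! (2 * l - 1) = u"
      using c(2) by (auto simp: vs nth_append nth_Cons')
    then show ?thesis
      using ex[OF cycle_rotate, of v w z r u "2 * l - 1"] assms(1) that True by (auto simp: vs)
  qed
qed

text \<open>By \<open>cycle_start\<close>, \<open>x\<close> is the end of a path with
  \<open>l\<close> edges inside the cycle, which such an edge would extend.\<close>

lemma cycle_no_single:
  assumes "cycle vs u" "e \<in> E"
  shows "e \<inter> insert u (set vs) \<noteq> {x}"
proof
  assume x: "e \<inter> insert u (set vs) = {x}"
  then have "x \<in> insert u (set vs)" "x \<in> e" by auto
  obtain us where us: "chain E us" "distinct us" "length us = 2 * l + 1" "hd us = x"
    "set us \<subseteq> insert u (set vs)"
    by (rule cycle_start[OF assms(1) \<open>x \<in> insert u (set vs)\<close>])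
  have "card (e - {x}) = 2" using uniform[OF assms(2)] \<open>x \<in> e\<close> by simp
  then obtain y z where yz: "e - {x} = {y, z}" by (auto simp: card_2_iff)
  then have "e = {x, y, z}" using \<open>x \<in> e\<close> by auto
  moreover have "y \<notin> set us" "z \<notin> set us" using yz x us(5) by auto
  ultimately show False using no_extension(1)[OF us(1-3)] us(4) assms(2) by auto
qed

lemma choose_2: "(2 * l choose 2) = l * (2 * l - 1)" "(2 * l + 1 choose 2) = l * (2 * l + 1)"
  by (simp_all add: choose_two)

lemma E_V_card: "e \<in> E \<Longrightarrow> e \<subseteq> V \<and> card e = 3"
  using E_V uniform by blast

lemma index_outside:
  assumes "x \<in> set vs - (!) vs ` I" "length vs = 2 * l + 1"
  shows "\<exists>j. j \<le> 2 * l \<and> x = vs ! j \<and> j \<notin> I"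
proof -
  obtain j where "j < length vs" "x = vs ! j" using assms(1) by (auto simp: in_set_conv_nth)
  then show ?thesis using assms by (intro exI[of _ j]) auto
qed

lemma end_variant:
  assumes "chain E vs" "distinct vs" "length vs = 2 * l + 1" "j \<le> 2 * l" "j \<notin> {2..2 * l - 2}"
  obtains us where "chain E us" "distinct us" "length us = 2 * l + 1" "set us = set vs" "hd us = vs ! j"
proof (cases "j \<le> 1")
  case True
  then show ?thesis
    using head_variant[OF assms(1,2) True] that assms(3,4) by (metis Suc_eq_plus1 less_Suc_eq_le)
next
  case False
  then have "2 * l - j \<le> 1" "2 * l - j < length (rev vs)" "rev vs ! (2 * l - j) = vs ! j"
    using assms by (auto simp: rev_nth)
  then show ?thesis
    using head_variant[of E "rev vs" "2 * l - j"] that assms(1-3)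
    by (metis chain_rev distinct_rev length_rev set_rev)
qed

text \<open>Two loose cycles on almost the same vertices force the degree of the vertex \<open>u\<close> outside
  the second one to be small.\<close>

lemma cycle_no_closing:
  assumes "cycle vs u"
  shows "no_closing (set vs) (V - insert u (set vs))"
proof -
  let ?S = "insert u (set vs)"
  let ?W = "V - ?S"
  have False if us: "chain E us" "distinct us" "length us = 2 * l + 1" "set us \<subseteq> insert w (set vs)"
    and w: "w \<in> ?W" and y: "y \<in> ?W - set us" and e: "{hd us, y, last us} \<in> E" for us w y
  proof -
    have vs: "chain E vs" "distinct vs" "length vs = 2 * l + 1" "u \<notin> set vs" "{hd vs, u, last vs} \<in> E"
      using assms by (auto simp: cycle_def)
    \<comment> \<open>This second cycle avoids \<open>u\<close>, and its vertices outside
      \<open>vs\<close> are among \<open>w\<close> and \<open>y\<close>.\<close>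
    have cyc: "cycle us y" using us y e by (simp add: cycle_def)
    have SV: "set vs \<subseteq> V" "u \<in> V" using chain_V[OF vs(1)] vs(3) l_ge E_V[OF vs(5)] by auto
    have cS: "card ?S = 2 * l + 2" using vs distinct_card[OF vs(2)] by simp
    have cW: "card ?W = card V - 2 * l - 2"
      using finite_V SV cS by (simp add: card_Diff_subset del: card_insert_disjoint)
    have W2: "2 \<le> card ?W" using cW card_V l_le by simp
    define D where "D x = {z \<in> ?W. {u, z, x} \<in> E}" for x
    define Y where "Y = (!) vs ` {2..2 * l - 2}"
    have Yfin: "finite Y" "card Y \<le> 2 * l - 3" "Y \<subseteq> set vs"
      using card_image_le[of "{2..2 * l - 2}" "(!) vs"] vs(3) l_ge by (auto simp: Y_def)
    have deg: "card {e \<in> E. u \<in> e} \<le> (card ?S - 1 choose 2) + (\<Sum>x\<in>?S - {u}. card (D x))"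
      unfolding D_def
      by (rule degree_le[OF finite_V E_V_card]) (use SV cycle_no_single[OF assms] in auto)
    \<comment> \<open>Such an \<open>x\<close> can be made an end of the path, which an edge through
      \<open>x\<close>, \<open>u\<close> and a vertex of \<open>?W\<close> would extend.\<close>
    have Dend: "D x = {}" if "x \<in> set vs - Y" for x
    proof -
      obtain j where j: "j \<le> 2 * l" "x = vs ! j" "j \<notin> {2..2 * l - 2}"
        using index_outside[OF _ vs(3)] \<open>x \<in> set vs - Y\<close> unfolding Y_def by metis
      obtain us' where us': "chain E us'" "distinct us'" "length us' = 2 * l + 1" "set us' = set vs"
        "hd us' = x"
        using end_variant[OF vs(1-3) j(1,3)] j(2) by metis
      show ?thesis
        using no_extension(1)[OF us'(1-3)] us'(4,5) vs(4) by (auto simp: D_def insert_commute)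
    qed
    \<comment> \<open>The edge must meet the second cycle in a vertex other than \<open>x\<close>;
      as \<open>u\<close> is not on it, this is the third vertex, hence \<open>w\<close> or
      \<open>y\<close>.\<close>
    have D2: "card (D x) \<le> 2" if "x \<in> set us" "x \<in> set vs" for x
    proof -
      have "D x \<subseteq> {w, y}"
      proof
        fix z assume z: "z \<in> D x"
        then have ze: "{u, z, x} \<in> E" "z \<in> ?W" by (auto simp: D_def)
        have "{u, z, x} \<inter> insert y (set us) \<noteq> {x}" by (rule cycle_no_single[OF cyc ze(1)])
        moreover have "u \<notin> insert y (set us)" using us(4) w y vs(4) by auto
        ultimately have "z \<in> insert y (set us)" using that by auto
        then show "z \<in> {w, y}" using us(4) ze(2) by auto
      qed
      then show ?thesis using card_mono[of "{w, y}" "D x"] card_length[of "[w, y]"] by simp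
    qed
    have Dall: "card (D x) \<le> card ?W" for x
      using finite_V by (intro card_mono) (auto simp: D_def)
    \<comment> \<open>The second cycle misses at most one vertex of the path, and only that one may
      contribute more than 2.\<close>
    define U where "U = Y - set us"
    have U: "card U \<le> 1"
    proof -
      have "2 * l \<le> card (set us - {w})" using us distinct_card[OF us(2)] by (simp add: card_Diff_singleton_if)
      also have "set us - {w} = set vs \<inter> set us" using us(4) w by auto
      finally have "2 * l \<le> card (set vs \<inter> set us)" .
      moreover have "card (set vs) = card (set vs \<inter> set us) + card (set vs - set us)"
        by (subst card_Un_disjoint[symmetric]) (auto intro: arg_cong[of _ _ card])
      ultimately have "card (set vs - set us) \<le> 1" using vs distinct_card[OF vs(2)] by simp
      moreover have "card U \<le> card (set vs - set us)" using Yfin by (intro card_mono) (auto simp: U_def)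
      ultimately show ?thesis by simp
    qed
    have "(\<Sum>x\<in>?S - {u}. card (D x)) = (\<Sum>x\<in>Y. card (D x))"
      using Yfin Dend vs(4) by (intro sum.mono_neutral_right) auto
    also have "\<dots> = (\<Sum>x\<in>U. card (D x)) + (\<Sum>x\<in>Y - U. card (D x))"
      using Yfin by (subst sum.subset_diff[of U Y]) (auto simp: U_def)
    also have "\<dots> \<le> (\<Sum>x\<in>U. card ?W) + (\<Sum>x\<in>Y - U. 2)"
      using Dall D2 Yfin by (intro add_mono sum_mono) (auto simp: U_def)
    also have "\<dots> = card U * card ?W + (card Y - card U) * 2"
      using Yfin by (simp add: U_def card_Diff_subset[of "Y - set us" Y])
    also have "\<dots> \<le> card ?W + (2 * l - 4) * 2"
    proof (cases "card U = 0")
      case True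
      then show ?thesis using Yfin(2) W2 l_ge by simp
    next
      case False
      then have "card U = 1" using U by simp
      then show ?thesis using Yfin(2) by simp
    qed
    finally have "card {e \<in> E. u \<in> e} \<le> l * (2 * l + 1) + (card V - 2 * l - 2) + (2 * l - 4) * 2"
      using deg cS cW choose_2(2) by simp
    then have "k * card V + 6 * k ^ 2 + 7 * k + 6 \<le> l * (2 * l + 1) + (card V - 2 * l - 2) + (2 * l - 4) * 2"
      using degree[OF SV(2)] by linarith
    then show False using second_cycle_degree_bound[OF k_pos l_ge l_le card_V] by linarith
  qed
  then show ?thesis unfolding no_closing_def by blast
qed

section \<open>More than \<open>k\<close> heavy neighbours at each end\<close>

lemma many_heavy_cycle:
  assumes cyc: "cycle vs u" and a: "a \<in> {vs ! 0, vs ! 1}"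
  shows "k < card {x \<in> set vs. heavy E (V - insert u (set vs)) a x}"
proof -
  let ?S = "insert u (set vs)"
  let ?W = "V - ?S"
  have vs: "chain E vs" "distinct vs" "length vs = 2 * l + 1" "u \<notin> set vs" "{hd vs, u, last vs} \<in> E"
    using cyc by (auto simp: cycle_def)
  obtain v w z r where vwz: "vs = v # w # z # r"
    using vs l_ge by (cases "(E, vs)" rule: chain.cases) auto
  obtain us where us: "chain E us" "distinct us" "length us = 2 * l + 1" "set us = set vs" "hd us = a"
    "\<And>j. 2 \<le> j \<Longrightarrow> us ! j = vs ! j"
  proof (cases "a = v")
    case True
    then have "hd vs = a" by (simp add: vwz)
    then show ?thesis by (intro that[of vs] vs) auto
  next
    case False
    have "(w # v # z # r) ! j = vs ! j" if "2 \<le> j" for j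
      using that by (cases j; cases "j - 1") (auto simp: vwz)
    moreover have "chain E (w # v # z # r)" using vs(1) chain_swap[of E v w z r] by (simp add: vwz)
    moreover have "a = w" "distinct (w # v # z # r)" "set (w # v # z # r) = set vs"
      "length (w # v # z # r) = 2 * l + 1"
      using a False vs(2,3) by (auto simp: vwz)
    ultimately show ?thesis by (intro that[of "w # v # z # r"]) simp_all
  qed
  \<comment> \<open>This rotated path runs from \<open>z\<close> to \<open>v\<close> and omits
    \<open>w\<close>; it controls the edges from \<open>a\<close> to the first three
    positions.\<close>
  define ws where "ws = z # r @ [u, v]"
  have cyc': "cycle ws w" using cycle_rotate[of v w z r u] cyc by (simp add: ws_def vwz)
  have ws: "chain E ws" "distinct ws" "length ws = 2 * l + 1" "hd ws = z" "last ws = v"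
    "insert w (set ws) = ?S"
    using cyc' by (auto simp: cycle_def ws_def vwz)
  define Y where "Y = (!) vs ` {3..2 * l - 2}"
  have aS: "a \<in> set vs" using us by (metis hd_in_set list.size(3) add_is_0 zero_neq_one)
  have "\<And>j. 3 \<le> j \<Longrightarrow> j \<le> 2 * l - 2 \<Longrightarrow> vs ! j \<in> set vs \<and> vs ! j \<noteq> vs ! 0 \<and> vs ! j \<noteq> vs ! 1"
    using vs(2,3) by (auto simp: nth_eq_iff_index_eq)
  then have Y: "Y \<subseteq> set vs - {a}" "card Y \<le> 2 * l - 4" "finite Y"
    using a card_image_le[of "{3..2 * l - 2}" "(!) vs"] by (auto simp: Y_def)
  have SV: "?S \<subseteq> V" using chain_V[OF vs(1)] vs(3) l_ge E_V[OF vs(5)] by auto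
  have cS: "card ?S = 2 * l + 2" using vs distinct_card[OF vs(2)] by simp
  have cW: "card ?W = card V - 2 * l - 2"
    using finite_V SV cS by (simp add: card_Diff_subset del: card_insert_disjoint)
  \<comment> \<open>The other \<open>x\<close> give a longer path (\<open>u\<close>, the pairs
    \<open>v\<close>, \<open>w\<close> and \<open>w\<close>, \<open>z\<close>) or a forbidden second
    cycle (the pair \<open>v\<close>, \<open>z\<close> and the last two positions).\<close>
  have zero: "{a, y, x} \<notin> E" if x: "x \<in> ?S - {a} - Y" and y: "y \<in> ?W" for x y
  proof (cases "x = u")
    case True
    then show ?thesis using no_extension(1)[OF us(1-3), of y u] us(4,5) y vs(4) by auto
  next
    case False
    then have "x \<in> set vs - (!) vs ` {3..2 * l - 2}" using x by (auto simp: Y_def)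
    then obtain j where j: "j \<le> 2 * l" "x = vs ! j" "j \<notin> {3..2 * l - 2}"
      using index_outside[OF _ vs(3)] by blast
    have yS: "y \<notin> set ws" "w \<notin> set ws" using y ws(6) cyc' by (auto simp: cycle_def)
    have vw: "{v, y, w} \<notin> E" "{w, y, v} \<notin> E"
      using no_extension(2)[OF ws(1-3) yS] ws(5) triple_rev[of w y v] by auto
    have zw: "{w, y, z} \<notin> E"
      using no_extension(1)[OF ws(1-3) yS] ws(4) triple_rev[of w y z] by auto
    have zv: "{v, y, z} \<notin> E"
      using cycle_no_closing[OF cyc'] ws(1-5) yS(1) y ws(6) triple_rev[of v y z]
      unfolding no_closing_def by (metis Diff_iff subset_insertI)
    consider "j = 0" | "j = 1" | "j = 2" | "3 \<le> j" by linarith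
    then show ?thesis
    proof cases
      case 4
      then have d: "2 * l - j \<le> 1" "2 * l - j < length us" "length us - Suc (2 * l - j) = j" "2 \<le> j"
        using j us(3) by auto
      obtain us' where us': "chain E us'" "distinct us'" "set us' = set us" "length us' = length us"
        "last us' = us ! (length us - Suc (2 * l - j))" "hd us' = hd us"
        by (rule tail_variant[OF us(1,2) d(1,2)])
      have "last us' = x" using us'(5) d(3,4) us(6) j(2) by simp
      then show ?thesis
        using cycle_no_closing[OF cyc] us' us(3-5) y
        unfolding no_closing_def by (metis Diff_iff insertCI subset_insertI)
    qed (use a x j vw zw zv in \<open>auto simp: vwz\<close>)
  qed
  have d1: "card {e \<in> E. a \<in> e} \<le>
    (card ?S - 1 choose 2) + 3 * card Y + (card ?W - 3) * card {x \<in> Y. heavy E ?W a x}"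
    by (rule degree_le_heavy[OF finite_V E_V_card SV _ cycle_no_single[OF cyc]])
      (use aS Y zero cW card_V l_le in auto)
  have d2: "k * card V + 6 * k ^ 2 + 7 * k + 6 \<le> card {e \<in> E. a \<in> e}"
    using degree[of a] aS SV by auto
  have e: "card ?S - 1 = 2 * l + 1" "card ?W - 3 = card V - 2 * l - 5"
    using cS cW by simp_all
  have "3 * card Y \<le> 3 * (2 * l - 4)" using Y(2) by simp
  then have "k * card V + 6 * k ^ 2 + 7 * k + 6 \<le>
      l * (2 * l + 1) + 3 * (2 * l - 4) + (card V - 2 * l - 5) * card {x \<in> Y. heavy E ?W a x}"
    using le_trans[OF d2 d1] unfolding e choose_2 by linarith
  then have "k < card {x \<in> Y. heavy E ?W a x}"
    using heavy_bound_cycle[OF k_pos l_ge l_le card_V] by blast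
  also have "\<dots> \<le> card {x \<in> set vs. heavy E ?W a x}"
    using Y(1) by (intro card_mono) auto
  finally show ?thesis .
qed

lemma many_heavy_path:
  assumes nocyc: "\<And>vs u. \<not> cycle vs u"
    and vs: "chain E vs" "distinct vs" "length vs = 2 * l + 1" and a: "a \<in> {vs ! 0, vs ! 1}"
  shows "k < card {x \<in> set vs. heavy E (V - set vs) a x}"
proof -
  let ?S = "set vs"
  let ?W = "V - ?S"
  obtain j where j: "j \<le> 1" "a = vs ! j" using a by auto
  then obtain us where us: "chain E us" "distinct us" "set us = set vs" "length us = length vs" "hd us = a"
    using head_variant[OF vs(1,2) j(1)] vs(3) l_ge by auto
  have us0: "us ! 0 = a" "a \<in> set us" using us(4,5) vs(3) by (cases us; auto)+
  define Y where "Y = (!) us ` {1..2 * l - 2}"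
  have "\<And>j. 1 \<le> j \<Longrightarrow> j \<le> 2 * l - 2 \<Longrightarrow> us ! j \<in> set us \<and> us ! j \<noteq> us ! 0"
    using us(2,4) vs(3) by (auto simp: nth_eq_iff_index_eq)
  then have Y: "Y \<subseteq> set vs - {a}" "card Y \<le> 2 * l - 2" "finite Y"
    using us(3) us0 card_image_le[of "{1..2 * l - 2}" "(!) us"] by (auto simp: Y_def)
  have SV: "?S \<subseteq> V" using chain_V[OF vs(1)] vs(3) l_ge by auto
  have cS: "card ?S = 2 * l + 1" using vs distinct_card[OF vs(2)] by simp
  have cW: "card ?W = card V - 2 * l - 1"
    using finite_V SV cS by (simp add: card_Diff_subset)
  \<comment> \<open>Only the last two positions are left, and an edge to either would close a loose
    cycle.\<close>
  have zero: "{a, y, x} \<notin> E" if x: "x \<in> ?S - {a} - Y" and y: "y \<in> ?W" for x y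
  proof
    assume e: "{a, y, x} \<in> E"
    have "x \<in> set us - (!) us ` {1..2 * l - 2}" using x us(3) by (auto simp: Y_def)
    then obtain j where j: "j \<le> 2 * l" "x = us ! j" "j \<notin> {1..2 * l - 2}"
      using index_outside us(4) vs(3) by metis
    then have "j \<noteq> 0" using x us0 by (cases j) auto
    then have d: "2 * l - j \<le> 1" "2 * l - j < length us" "length us - Suc (2 * l - j) = j"
      using j us(4) vs(3) by auto
    obtain us' where us': "chain E us'" "distinct us'" "set us' = set us" "length us' = length us"
      "last us' = us ! (length us - Suc (2 * l - j))" "hd us' = hd us"
      by (rule tail_variant[OF us(1,2) d(1,2)])
    then have "cycle us' y" using e us y vs(3) d(3) j(2) by (simp add: cycle_def)
    then show False using nocyc by blast
  qed
  have single: "e \<inter> ?S \<noteq> {a}" if "e \<in> E" for e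
  proof
    assume x: "e \<inter> ?S = {a}"
    have "card (e - {a}) = 2" using uniform[OF that] x by (subst card_Diff_singleton) auto
    then obtain y z where yz: "e - {a} = {y, z}" by (auto simp: card_2_iff)
    then have "e = {a, y, z}" using x by auto
    moreover have "y \<notin> set us" "z \<notin> set us" using yz x us(3) by auto
    ultimately show False using no_extension(1)[OF us(1,2)] us(4,5) vs(3) that by auto
  qed
  have d1: "card {e \<in> E. a \<in> e} \<le>
    (card ?S - 1 choose 2) + 3 * card Y + (card ?W - 3) * card {x \<in> Y. heavy E ?W a x}"
    by (rule degree_le_heavy[OF finite_V E_V_card SV _ single])
      (use us0 us(3) Y zero cW card_V l_le in auto)
  have d2: "k * card V + 6 * k ^ 2 + 7 * k + 6 \<le> card {e \<in> E. a \<in> e}"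
    using degree[of a] us0 us(3) SV by auto
  have e: "card ?S - 1 = 2 * l" "card ?W - 3 = card V - 2 * l - 4"
    using cS cW by simp_all
  have "3 * card Y \<le> 3 * (2 * l - 2)" using Y(2) by simp
  then have "k * card V + 6 * k ^ 2 + 7 * k + 6 \<le>
      l * (2 * l - 1) + 3 * (2 * l - 2) + (card V - 2 * l - 4) * card {x \<in> Y. heavy E ?W a x}"
    using le_trans[OF d2 d1] unfolding e choose_2 by linarith
  then have "k < card {x \<in> Y. heavy E ?W a x}"
    using heavy_bound_path[OF k_pos l_ge l_le card_V] by blast
  also have "\<dots> \<le> card {x \<in> set vs. heavy E ?W a x}"
    using Y(1) by (intro card_mono) auto
  finally show ?thesis .
qed

text \<open>Two ends with at least \<open>k + 1\<close> heavy neighbours each contradict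
  \<open>few_heavy\<close>, since \<open>l \<le> 2 * k + 1\<close>. If a loose cycle exists, the
  given path is replaced by one inside it.\<close>

lemma no_longest:
  assumes "chain E vs" "distinct vs" "length vs = 2 * l + 1"
  shows False
proof -
  \<comment> \<open>\<open>many\<close> covers both degree-one vertices of each end edge, because
    \<open>few_heavy\<close> leaves open which of them it selects.\<close>
  obtain W vs where W: "longest_in W vs"
    and many: "\<And>a us. us = vs \<or> us = rev vs \<Longrightarrow> a \<in> {us ! 0, us ! 1} \<Longrightarrow>
      k < card {x \<in> set vs. heavy E W a x}"
  proof (cases "\<exists>vs u. cycle vs u")
    case True
    then obtain vs u where c: "cycle vs u" by blast
    have "longest_in (V - insert u (set vs)) vs"
      using c cycle_no_closing[OF c] by (auto simp: longest_in_def cycle_def)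
    moreover have "k < card {x \<in> set vs. heavy E (V - insert u (set vs)) a x}"
      if "us = vs \<or> us = rev vs" "a \<in> {us ! 0, us ! 1}" for a us
      using that many_heavy_cycle[OF c, of a] many_heavy_cycle[OF cycle_rev[OF c], of a] by auto
    ultimately show ?thesis by (rule that)
  next
    case False
    then have nocyc: "\<not> cycle vs u" for vs u by blast
    have "no_closing (set vs) (V - set vs)"
      unfolding no_closing_def using nocyc by (auto simp: cycle_def)
    then have "longest_in (V - set vs) vs"
      using assms by (auto simp: longest_in_def)
    moreover have "k < card {x \<in> set vs. heavy E (V - set vs) a x}"
      if "us = vs \<or> us = rev vs" "a \<in> {us ! 0, us ! 1}" for a us
      using that many_heavy_path[OF nocyc assms, of a] many_heavy_path[OF nocyc, of "rev vs" a] assms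
      by auto
    ultimately show ?thesis by (rule that)
  qed
  have "length vs = 2 * l + 1" using W by (simp add: longest_in_def)
  then have r: "vs ! (2 * l) = rev vs ! 0" "vs ! (2 * l - 1) = rev vs ! 1"
    using l_ge by (auto simp: rev_nth)
  obtain a b where "a \<in> {vs ! 0, vs ! 1}" "b \<in> {rev vs ! 0, rev vs ! 1}"
    "card {x \<in> set vs. heavy E W a x} + card {x \<in> set vs. heavy E W b x} \<le> l"
    using few_heavy[OF W l_ge] unfolding r by blast
  then show False using many[of vs a] many[of "rev vs" b] l_le by fastforce
qed

end

section \<open>A path with two edges, and the conclusion\<close>

lemma two_edges:
  fixes E :: "'a set set"
  assumes "finite V" and E: "\<And>e. e \<in> E \<Longrightarrow> e \<subseteq> V \<and> card e = 3" and e: "e \<in> E"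
    and deg: "\<And>v. v \<in> V \<Longrightarrow> card V < card {e \<in> E. v \<in> e}" and V: "5 \<le> card V"
  shows "\<exists>vs. chain E vs \<and> distinct vs \<and> length vs = 5"
proof (rule ccontr)
  assume no: "\<not> ?thesis"
  obtain a b c where abc: "e = {a, b, c}" "a \<noteq> b" "a \<noteq> c" "b \<noteq> c"
    using E[OF e] by (auto simp: card_3_iff)
  have S: "{a, b, c} \<subseteq> V" using E[OF e] abc by auto
  define D where "D x = {y \<in> V - {a, b, c}. {a, y, x} \<in> E}" for x
  have fin: "finite (D x)" for x using assms(1) by (simp add: D_def)
  \<comment> \<open>Two edges with exactly one common vertex already form the desired path.\<close>
  have single: "f \<inter> {a, b, c} \<noteq> {a}" if f: "f \<in> E" for f
  proof
    assume x: "f \<inter> {a, b, c} = {a}"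
    have "card (f - {a}) = 2" using E[OF f] x by (subst card_Diff_singleton) auto
    then obtain y z where yz: "f - {a} = {y, z}" "y \<noteq> z" by (auto simp: card_2_iff)
    then have "f = {y, z, a}" using x by auto
    moreover have "y \<notin> {a, b, c}" "z \<notin> {a, b, c}" using yz x by auto
    ultimately have "chain E [y, z, a, b, c]" "distinct [y, z, a, b, c]" using f e abc yz by auto
    then show False using no by (metis length_Cons list.size(3) numeral_eq_Suc pred_numeral_simps(1,2,3) BitM.simps eval_nat_numeral(2,3))
  qed
  have "card {f \<in> E. a \<in> f} \<le> (card {a, b, c} - 1 choose 2) + (\<Sum>x\<in>{a, b, c} - {a}. card (D x))"
    unfolding D_def by (rule degree_le[OF assms(1) E S _ single]) auto
  also have "\<dots> = 1 + (card (D b) + card (D c))"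
  proof -
    have "{a, b, c} - {a} = {b, c}" "card {a, b, c} = 3" using abc by auto
    then show ?thesis using abc by (simp add: choose_two)
  qed
  also have "card (D b) + card (D c) \<le> card V - 3"
  proof -
    \<comment> \<open>Different \<open>y\<close> and \<open>y'\<close> give two edges meeting only
      in \<open>a\<close>. Hence one of \<open>D b\<close> and \<open>D c\<close> is empty, or both
      are the same singleton.\<close>
    have same: "y = y'" if y: "y \<in> D b" "y' \<in> D c" for y y'
    proof (rule ccontr)
      assume "y \<noteq> y'"
      then have "chain E [b, y, a, y', c]" "distinct [b, y, a, y', c]"
        using y abc triple_rev[of b y a] by (auto simp: D_def)
      then show False using no by (auto dest: spec[of _ "[b, y, a, y', c]"])
    qed
    have le: "card (D x) \<le> card V - 3" for x
    proof -
      have "card (D x) \<le> card (V - {a, b, c})" using assms(1) by (intro card_mono) (auto simp: D_def)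
      also have "\<dots> = card V - 3" using S abc assms(1) by (simp add: card_Diff_subset)
      finally show ?thesis .
    qed
    show ?thesis
    proof (cases "D b = {} \<or> D c = {}")
      case True
      then show ?thesis using le by auto
    next
      case False
      then obtain y where "y \<in> D b" by auto
      then have "D c \<subseteq> {y}" using same by auto
      moreover from this have "D b \<subseteq> {y}" using same False by blast
      ultimately have "card (D b) \<le> card {y}" "card (D c) \<le> card {y}" by (intro card_mono; simp)+
      then show ?thesis using V by simp
    qed
  qed
  finally show False using deg[of a] S V by simp
qed

theorem theorem2p6:
  fixes V :: "'a set" and E :: "'a set set" and k n :: nat
  assumes "k > 0" and "n \<ge> 4 * k + 21"
    and "three_graph V E" and "card V = n"
    and "min_vertex_degree V E \<ge> k * n + 6 * k ^ 2 + 7 * k + 6"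
  shows "\<exists>es. length es = 2 * k + 2 \<and> linear_path E es"
proof (rule ccontr)
  assume no: "\<not> ?thesis"
  have V: "finite V" and E: "\<And>e. e \<in> E \<Longrightarrow> e \<subseteq> V \<and> card e = 3"
    using assms(3) by (auto simp: three_graph_def)
  have deg: "k * card V + 6 * k ^ 2 + 7 * k + 6 \<le> card {e \<in> E. v \<in> e}" if "v \<in> V" for v
  proof -
    have "min_vertex_degree V E \<le> vertex_degree E v"
      using V that by (simp add: min_vertex_degree_def)
    then show ?thesis using assms(4,5) by (simp add: vertex_degree_def)
  qed
  have deg': "card V < card {e \<in> E. v \<in> e}" if "v \<in> V" for v
  proof -
    have "card V \<le> k * card V" using assms(1) by simp
    then show ?thesis using deg[OF that] by linarith
  qed
  obtain e where "e \<in> E"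
  proof -
    obtain v where "v \<in> V" using assms(2,4) by fastforce
    then have "card {e \<in> E. v \<in> e} \<noteq> 0" using deg'[of v] by linarith
    then have "{e \<in> E. v \<in> e} \<noteq> {}" by (metis card.empty)
    then show ?thesis using that by auto
  qed
  then obtain vs5 where vs5: "chain E vs5" "distinct vs5" "length vs5 = 5"
    using two_edges[OF V E _ deg'] assms(2,4) by fastforce
  define P where "P i \<longleftrightarrow> (\<exists>vs. chain E vs \<and> distinct vs \<and> length vs = 2 * i + 1)" for i
  \<comment> \<open>A longer path has an initial segment with exactly \<open>2 * k + 2\<close>
    edges; \<open>?m\<close> is the number of its vertices.\<close>
  have bound: "i \<le> 2 * k + 1" if Pi: "P i" for i
  proof (rule ccontr)
    assume i: "\<not> i \<le> 2 * k + 1"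
    obtain vs where vs: "chain E vs" "distinct vs" "length vs = 2 * i + 1"
      using Pi by (auto simp: P_def)
    let ?m = "2 * (2 * k + 2) + 1"
    have "chain E (take ?m vs)"
    proof (cases "?m = length vs")
      case False
      then show ?thesis using chain_split(1)[OF vs(1), of ?m] vs(3) i by auto
    qed (use vs in auto)
    then show False
      using linear_path_chain[of E "take ?m vs" "2 * k + 2"] vs i no by auto
  qed
  define l where "l = (GREATEST i. P i)"
  \<comment> \<open>This gives \<open>2 \<le> l\<close>, and with it two disjoint pairs of
    candidates for the ends.\<close>
  have P2: "P 2" using vs5 by (auto simp: P_def)
  have Pl: "P l" unfolding l_def by (rule GreatestI_nat[of P 2, OF P2 bound])
  have max: "i \<le> l" if "P i" for i unfolding l_def by (rule Greatest_le_nat[of P i, OF that bound])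
  interpret dense E l V k
  proof
    fix vs assume vs: "chain E vs" "distinct vs"
    then obtain i where i: "length vs = 2 * i + 1" using chain_odd oddE by blast
    then have "P i" using vs by (auto simp: P_def)
    then show "length vs \<le> 2 * l + 1" using max i by simp
  qed (use V E deg assms max[OF P2] bound[OF Pl] in auto)
  show False using Pl no_longest by (auto simp: P_def)
qed

end
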